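(* Let $F:\mathbb{R}_+\to\mathbb{R}$ be measurable, positive and locally bounded. Let $\alpha\in\mathbb{R}$, $\rho\le 0$ and $A\in\mathscr{A}^\infty_\rho$. Then $F\in\mathrm{2RV}^\infty_{\alpha,\rho}(A)$ if and only if there exist two constants $\zeta_1,\zeta_2\ne 0$ and a function $A_1\in\mathscr{A}^\infty_\rho$ such that $$\frac{A(t)}{A_1(t)}\to\rho\,\zeta_2+1>0\quad\text{as }t\to\infty$$ and $$F(t)=\zeta_1\cdot\big(1+\zeta_2\cdot A_1(t)\big)\cdot\exp\Big\{\int_1^t s^{-1}A_1(s)\,ds\Big\}\cdot t^\alpha,\qquad t>0.$$ Moreover (when $F\in\mathrm{2RV}^\infty_{\alpha,\rho}(A)$), for any $\vartheta<-\alpha$ the two constants can be chosen as $$\zeta_1=-(\alpha+\vartheta)\int_1^\infty s^{\vartheta-1}F(s)\,ds\quad\text{and}\quad\zeta_2=\frac{1}{\alpha+\vartheta}.$$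
   Context: A measurable function $F:\mathbb{R}_+\to\mathbb{R}$ is regularly varying at infinity with index $\alpha\in\mathbb{R}$, written $F\in\mathrm{RV}^\infty_\alpha$, if it has constant sign near infinity and $\lim_{t\to\infty}F(tx)/F(t)=x^\alpha$ for every $x>0$. A function $F\in\mathrm{RV}^\infty_\alpha$ belongs to $\mathrm{2RV}^\infty_{\alpha,\rho}(A)$ (second-order regular variation with first-order index $\alpha$, second-order index $\rho$ and auxiliary function $A$, where $A$ is an eventually positive or eventually negative function on $\mathbb{R}_+$) if for every $x>0$ $$\lim_{t\to\infty}\frac{F(tx)/F(t)-x^\alpha}{A(t)}=x^\alpha\int_1^x u^{\rho-1}\,du .$$ For $\rho\le 0$, $\mathscr{A}^\infty_\rho:=\{A\in\mathrm{RV}^\infty_\rho:\lim_{t\to\infty}A(t)=0\}$. *)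

theory Defs
  imports "HOL-Analysis.Analysis"
begin

text \<open>
  Functions on \<open>\<real>\<^sub>+ = (0, \<infinity>)\<close> are modelled as total functions on \<^typ>\<open>real\<close>; all
  conditions only concern their values at positive arguments.
\<close>

definition constant_sign_near_infinity :: "(real \<Rightarrow> real) \<Rightarrow> bool" where
  "constant_sign_near_infinity f \<longleftrightarrow>
     eventually (\<lambda>t. f t > 0) at_top \<or> eventually (\<lambda>t. f t < 0) at_top"

definition locally_bounded_on :: "real set \<Rightarrow> (real \<Rightarrow> real) \<Rightarrow> bool" where
  "locally_bounded_on S f \<longleftrightarrow> (\<forall>K. compact K \<and> K \<subseteq> S \<longrightarrow> bounded (f ` K))"

definition RV_infty :: "real \<Rightarrow> (real \<Rightarrow> real) set" where
  "RV_infty \<alpha> = {F.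
     F \<in> borel_measurable (restrict_space borel {0<..}) \<and>
     constant_sign_near_infinity F \<and>
     (\<forall>x>0. ((\<lambda>t. F (t * x) / F t) \<longlongrightarrow> x powr \<alpha>) at_top)}"

text \<open>The interval integral is signed, as needed for \<open>x < 1\<close>.\<close>

definition SecondRV_infty :: "real \<Rightarrow> real \<Rightarrow> (real \<Rightarrow> real) \<Rightarrow> (real \<Rightarrow> real) set" where
  "SecondRV_infty \<alpha> \<rho> A = {F \<in> RV_infty \<alpha>.
     constant_sign_near_infinity A \<and>
     (\<forall>x>0. ((\<lambda>t. (F (t * x) / F t - x powr \<alpha>) / A t) \<longlongrightarrow>
               x powr \<alpha> * (LBINT u=ereal 1..ereal x. u powr (\<rho> - 1))) at_top)}"

definition Aux_infty :: "real \<Rightarrow> (real \<Rightarrow> real) set" where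
  "Aux_infty \<rho> = {A \<in> RV_infty \<rho>. (A \<longlongrightarrow> 0) at_top}"

text \<open>
  The integrability clause makes explicit that the integral in the exponent exists; the
  library's integral of a non-integrable function is \<open>0\<close>.
\<close>

definition second_order_representation ::
  "(real \<Rightarrow> real) \<Rightarrow> real \<Rightarrow> real \<Rightarrow> (real \<Rightarrow> real) \<Rightarrow> real \<Rightarrow> real \<Rightarrow> (real \<Rightarrow> real) \<Rightarrow> bool" where
  "second_order_representation F \<alpha> \<rho> A \<zeta>\<^sub>1 \<zeta>\<^sub>2 A\<^sub>1 \<longleftrightarrow>
     \<zeta>\<^sub>1 \<noteq> 0 \<and> \<zeta>\<^sub>2 \<noteq> 0 \<and> A\<^sub>1 \<in> Aux_infty \<rho> \<and>
     ((\<lambda>t. A t / A\<^sub>1 t) \<longlongrightarrow> \<rho> * \<zeta>\<^sub>2 + 1) at_top \<and> \<rho> * \<zeta>\<^sub>2 + 1 > 0 \<and>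
     (\<forall>t>0. interval_lebesgue_integrable lborel (ereal 1) (ereal t) (\<lambda>s. A\<^sub>1 s / s) \<and>
        F t = \<zeta>\<^sub>1 * (1 + \<zeta>\<^sub>2 * A\<^sub>1 t) * exp (LBINT s=ereal 1..ereal t. A\<^sub>1 s / s) * t powr \<alpha>)"

end

(*
  Necessity: put c = -(alpha + theta) > 0, p(s) = s^(theta-1) F(s), I(t) = int_t^oo p and
  A1(t) = c - t p(t) / I(t).  Since p / I is minus the logarithmic derivative of I, the
  representation with zeta1 = c I(1) and zeta2 = -1/c is an identity; what remains is
  A / A1 --> 1 - rho / c, a second-order Karamata theorem obtained by dominated convergence.
  Sufficiency: F(tx) / F(t) is expanded to first order in A1(t), using
  int_t^(tx) A1(s)/s ds ~ A1(t) int_1^x u^(rho-1) du.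
  Both dominations rest on bounds that are uniform in the scale x, deduced from pointwise limits
  of measurable functions by an overlap argument for sets of large measure.
*)

theory Submission
  imports Defs
begin

text \<open>F is merely measurable, while the exponential in the representation is continuous in t,
  so the irregularity of F has to sit in the factor
  \<open>1 + \<zeta>\<^sub>2 * A\<^sub>1 t\<close>. The tail integral I produces this splitting.
  Formally A1 = c + t I'(t) / I(t), which integrates to I(t) = I(1) t^(-c) exp(int_1^t A1(s)/s ds).
  Then F is read off from the density p(t) = I(t) (c - A1(t)) / t, and factoring c out of c - A1
  yields zeta2 = -1/c. The limit of A / A1 is forced. With k(x) = int_1^x u^(rho-1) du, the two
  first-order contributions to F(tx) / F(t) are zeta2 (x^rho - 1) and k(x), and x^rho - 1 = rho
  k(x), so they add up to (rho zeta2 + 1) k(x). The definitions give limits for each fixed x only,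
  and the tail integral runs over unboundedly many scales. Besides locally uniform bounds this
  requires a global one, with a loss u^epsilon; epsilon = c/2 spends half of the decay u^(-c-1) and
  leaves an integrable majorant.\<close>

subsection \<open>Uniform bounds for regularly varying functions\<close>

text \<open>Overlap argument: the sets of good increments from \<open>X n\<close> and from \<open>X n + u n\<close> (the latter
  translated by \<open>u n\<close>) both have measure above \<open>3 / 2 * T\<close> inside \<open>{0..3 * T}\<close>, so they meet.\<close>

lemma uniform_increment_bound:
  fixes h a :: "real \<Rightarrow> real"
  assumes h [measurable]: "h \<in> borel_measurable borel" and "T > 0"
    and bnd: "\<And>y. 0 \<le> y \<Longrightarrow> y \<le> 2 * T \<Longrightarrow> eventually (\<lambda>x. \<bar>h (x + y) - h x\<bar> \<le> a x) at_top"
  shows "eventually (\<lambda>x. \<forall>u\<in>{0..T}. \<bar>h (x + u) - h x\<bar> \<le> a x + a (x + u)) at_top"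
proof (rule ccontr)
  assume "\<not> ?thesis"
  then have "\<forall>n::nat. \<exists>x\<ge>real n. \<exists>u\<in>{0..T}. \<not> \<bar>h (x + u) - h x\<bar> \<le> a x + a (x + u)"
    by (auto simp: eventually_at_top_linorder)
  then obtain X u where X: "\<And>n::nat. X n \<ge> real n" and u: "\<And>n. u n \<in> {0..T}"
    and bad: "\<And>n. \<not> \<bar>h (X n + u n) - h (X n)\<bar> \<le> a (X n) + a (X n + u n)"
    by metis
  \<comment> \<open>Demanding the bound for all \<open>m \<ge> n\<close> makes these sets increase
    with \<open>n\<close>, and the pointwise hypothesis makes their union all of
    \<open>{0..2 * T}\<close>, so continuity of measure applies. The sequence \<open>Y\<close> is
    left open because both \<open>X\<close> and \<open>X + u\<close> are inserted for it.\<close>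
  define V where "V Y n = {y\<in>{0..2 * T}. \<forall>m\<ge>n. \<bar>h (Y m + y) - h (Y m)\<bar> \<le> a (Y m)}"
    for Y :: "nat \<Rightarrow> real" and n :: nat
  have V_sets: "V Y n \<in> sets borel" for Y n
    unfolding V_def by measurable
  have V_lm: "V Y n \<in> lmeasurable" for Y n
  proof (rule bounded_set_imp_lmeasurable)
    show "bounded (V Y n)"
      by (rule bounded_subset[of "{0..2*T}"]) (auto simp: V_def)
    show "V Y n \<in> sets lebesgue"
      using V_sets[of Y n] by simp
  qed
  have V_large: "eventually (\<lambda>n. measure lebesgue (V Y n) > 3 / 2 * T) sequentially"
    if Y: "\<And>n. Y n \<ge> real n" for Y
  proof -
    have Ytop: "filterlim Y at_top sequentially"
      using Y by (intro filterlim_at_top_mono[OF filterlim_real_sequentially]) auto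
    have Un: "(\<Union>n. V Y n) = {0..2 * T}"
    proof (intro equalityI subsetI)
      fix y assume y: "y \<in> {0..2*T}"
      have "eventually (\<lambda>n. \<bar>h (Y n + y) - h (Y n)\<bar> \<le> a (Y n)) sequentially"
        using eventually_compose_filterlim[OF bnd[of y] Ytop] y by auto
      then show "y \<in> (\<Union>n. V Y n)"
        using y by (auto simp: V_def eventually_sequentially)
    qed (auto simp: V_def)
    have "(\<lambda>n. measure lebesgue (V Y n)) \<longlonglongrightarrow> measure lebesgue (\<Union>n. V Y n)"
    proof (rule Lim_measure_incseq)
      show "incseq (V Y)"
        by (auto simp: incseq_def V_def)
      show "range (V Y) \<subseteq> sets lebesgue"
        using V_lm by (auto intro: fmeasurableD)
      show "emeasure lebesgue (\<Union>n. V Y n) \<noteq> \<infinity>"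
        using \<open>T > 0\<close> unfolding Un by simp
    qed
    then have "(\<lambda>n. measure lebesgue (V Y n)) \<longlonglongrightarrow> 2 * T"
      using \<open>T > 0\<close> by (simp add: Un)
    then show ?thesis
      using order_tendstoD(1)[of _ "2 * T" sequentially "3 / 2 * T"] \<open>T > 0\<close> by auto
  qed
  define Z where "Z n = X n + u n" for n
  have Z: "Z n \<ge> real n" for n
    using X[of n] u[of n] by (auto simp: Z_def)
  have "eventually (\<lambda>n. measure lebesgue (V X n) > 3 / 2 * T \<and> measure lebesgue (V Z n) > 3 / 2 * T) sequentially"
    by (intro eventually_conj V_large X Z)
  then obtain n where n: "measure lebesgue (V X n) > 3 / 2 * T" "measure lebesgue (V Z n) > 3 / 2 * T"
    by (auto simp: eventually_sequentially)
  let ?W = "(+) (u n) ` V Z n"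
  have W: "?W \<in> lmeasurable" "measure lebesgue ?W = measure lebesgue (V Z n)"
    by (rule measurable_translation[OF V_lm], rule measure_translation)
  have "V X n \<inter> ?W \<noteq> {}"
  proof
    assume disj: "V X n \<inter> ?W = {}"
    have "?W - V X n = ?W"
      using disj by blast
    then have "measure lebesgue (V X n \<union> ?W) = measure lebesgue (V X n) + measure lebesgue ?W"
      using measure_Un2[OF V_lm W(1), of X n] by simp
    moreover have "measure lebesgue (V X n \<union> ?W) \<le> measure lebesgue {0..3 * T}"
    proof (rule measure_mono_fmeasurable)
      show "V X n \<union> ?W \<subseteq> {0..3 * T}"
        using u[of n] by (auto simp: V_def)
      show "V X n \<union> ?W \<in> sets lebesgue"
        using V_lm W(1) by (intro sets.Un fmeasurableD)
    qed simp
    ultimately show False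
      using n W(2) \<open>T > 0\<close> by simp
  qed
  then obtain w where "u n + w \<in> V X n" "w \<in> V Z n"
    by auto
  then obtain z where "z \<in> V X n" "z - u n \<in> V Z n"
    using that by (metis add_diff_cancel_left')
  \<comment> \<open>Both increments end at the same point \<open>X n + z\<close>, so their
    difference is the increment from \<open>X n\<close> to \<open>X n + u n\<close>; the triangle
    inequality contradicts \<open>bad\<close>.\<close>
  then have "\<bar>h (X n + z) - h (X n)\<bar> \<le> a (X n)" "\<bar>h (Z n + (z - u n)) - h (Z n)\<bar> \<le> a (Z n)"
    by (auto simp: V_def)
  with bad[of n] show False
    by (simp add: Z_def)
qed

text \<open>The overlap argument is additive and wants a Borel function on the whole line, whereas F
  is known to be measurable on the positive half-line only. The exponential bridges both
  gaps.\<close>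

lemma borel_measurable_exp_compose:
  assumes "F \<in> borel_measurable (restrict_space borel {0<..})"
  shows "(\<lambda>x::real. F (exp x)) \<in> borel_measurable borel"
  by (rule measurable_compose[OF _ assms]) (auto intro!: measurable_restrict_space2)

lemma RV_infty_nonzero: "F \<in> RV_infty \<beta> \<Longrightarrow> eventually (\<lambda>t. F t \<noteq> 0) at_top"
  by (auto simp: RV_infty_def constant_sign_near_infinity_def elim: eventually_mono)

text \<open>On the logarithmic scale ratios become increments of \<open>h\<close>, whose pointwise
  limits \<beta> y are bounded on compact sets, so the overlap argument bounds them uniformly. The
  absolute value inside \<open>ln\<close> admits eventually negative functions such as A.\<close>

lemma RV_infty_ratio_bounded:
  assumes F: "F \<in> RV_infty \<beta>" and X: "X > 1"
  obtains K where "K > 0" "eventually (\<lambda>t. \<forall>u\<in>{1 / X..X}. \<bar>F (t * u) / F t\<bar> \<le> K) at_top"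
proof -
  define T where "T = ln X"
  have T: "T > 0" using X by (simp add: T_def)
  define h where "h x = ln \<bar>F (exp x)\<bar>" for x
  \<comment> \<open>\<bar>\<beta> y\<bar> is at most \<open>\<bar>\<beta>\<bar> * (2 * T)\<close>
    for \<open>y\<close> in \<open>{0..2 * T}\<close>; the summand 1 makes the inequality strict, so
    that it passes from the limit to all large \<open>x\<close>.\<close>
  define M where "M = \<bar>\<beta>\<bar> * (2 * T) + 1"
  have F0: "eventually (\<lambda>x. F (exp x) \<noteq> 0) at_top"
    using eventually_compose_filterlim[OF RV_infty_nonzero[OF F] exp_at_top] .
  have [measurable]: "(\<lambda>x. F (exp x)) \<in> borel_measurable borel"
    using F by (intro borel_measurable_exp_compose) (auto simp: RV_infty_def)
  have h: "h \<in> borel_measurable borel"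
    unfolding h_def by measurable
  have shift: "eventually (\<lambda>x. F (exp (x + y)) \<noteq> 0) at_top" for y
    using eventually_compose_filterlim[OF F0 filterlim_tendsto_add_at_top[OF tendsto_const[of y] filterlim_ident]]
    by (simp add: add.commute)
  have "eventually (\<lambda>x. \<bar>h (x + y) - h x\<bar> \<le> M) at_top" if y: "0 \<le> y" "y \<le> 2 * T" for y
  proof -
    have "((\<lambda>x. F (exp x * exp y) / F (exp x)) \<longlongrightarrow> exp y powr \<beta>) at_top"
      using F filterlim_compose[OF _ exp_at_top, of "\<lambda>t. F (t * exp y) / F t"] by (auto simp: RV_infty_def)
    then have "((\<lambda>x. ln \<bar>F (exp x * exp y) / F (exp x)\<bar>) \<longlongrightarrow> ln \<bar>exp y powr \<beta>\<bar>) at_top"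
      by (intro tendsto_intros) auto
    moreover have "\<bar>ln \<bar>exp y powr \<beta>\<bar>\<bar> < M"
    proof -
      have "ln \<bar>exp y powr \<beta>\<bar> = \<beta> * y"
        by (simp add: powr_def)
      moreover have "\<bar>\<beta>\<bar> * \<bar>y\<bar> \<le> \<bar>\<beta>\<bar> * (2 * T)"
        using y by (intro mult_left_mono) auto
      ultimately show ?thesis
        by (simp add: M_def abs_mult)
    qed
    ultimately have "eventually (\<lambda>x. \<bar>ln \<bar>F (exp x * exp y) / F (exp x)\<bar>\<bar> < M) at_top"
      by (intro order_tendstoD(2)[OF tendsto_rabs])
    with F0 shift[of y] show ?thesis
      by eventually_elim (simp add: h_def exp_add ln_div abs_divide)
  qed
  from uniform_increment_bound[OF h T this]
  have ev: "eventually (\<lambda>x. \<forall>u\<in>{0..T}. \<bar>h (x + u) - h x\<bar> \<le> 2 * M) at_top"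
    by simp
  obtain x0 where x0: "\<And>x. x \<ge> x0 \<Longrightarrow> F (exp x) \<noteq> 0 \<and> (\<forall>u\<in>{0..T}. \<bar>h (x + u) - h x\<bar> \<le> 2 * M)"
    using eventually_conj[OF F0 ev] by (auto simp: eventually_at_top_linorder)
  have "\<bar>F (t * u) / F t\<bar> \<le> exp (2 * M)" if t: "t \<ge> exp (x0 + T)" and u: "u \<in> {1 / X..X}" for t u
  proof -
    have pos: "0 < t" "0 < u"
      using less_le_trans[OF exp_gt_zero t] u X by (auto intro: less_le_trans[of 0 "1 / X"])
    define x v where "x = ln t" and "v = ln u"
    have tu: "t = exp x" "u = exp v"
      using pos by (auto simp: x_def v_def)
    have x: "x \<ge> x0 + T"
      using t by (simp add: tu)
    have "exp (- T) \<le> u" "u \<le> exp T"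
      using u X by (auto simp: T_def exp_minus inverse_eq_divide)
    then have v: "- T \<le> v" "v \<le> T"
      by (auto simp: tu)
    have "\<bar>h (x + v) - h x\<bar> \<le> 2 * M"
    \<comment> \<open>The uniform bound covers nonnegative increments. A negative \<open>v\<close>
      is the increment \<open>- v\<close> seen from \<open>x + v\<close>, and starting at
      \<open>x0 + T\<close> keeps that base point above \<open>x0\<close>.\<close>
    proof (cases "v \<ge> 0")
      case True
      then show ?thesis using x0[of x] x v T by auto
    next
      case False
      then show ?thesis using x0[of "x + v"] x v T by (auto dest!: bspec[of _ _ "- v"])
    qed
    moreover have "F (exp (x + v)) \<noteq> 0" "F (exp x) \<noteq> 0"
      using x0[of x] x0[of "x + v"] x v T by auto
    ultimately have "ln \<bar>F (t * u) / F t\<bar> \<le> 2 * M" "\<bar>F (t * u) / F t\<bar> > 0"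
      by (auto simp: h_def tu exp_add[symmetric] ln_div abs_divide)
    then show ?thesis
      by (metis exp_le_cancel_iff exp_ln)
  qed
  then have "eventually (\<lambda>t. \<forall>u\<in>{1 / X..X}. \<bar>F (t * u) / F t\<bar> \<le> exp (2 * M)) at_top"
    unfolding eventually_at_top_linorder by blast
  then show ?thesis
    by (rule that[OF exp_gt_zero])
qed

section \<open>The kernel int_1^x u^(rho-1) du\<close>

text \<open>The antiderivative of u^(rho-1) that vanishes at 1, that is, the integral in
  \<open>SecondRV_infty\<close> in closed form. The logarithm is the limit of the other branch as
  rho tends to 0.\<close>

definition power_kernel :: "real \<Rightarrow> real \<Rightarrow> real" where
  "power_kernel \<rho> u = (if \<rho> = 0 then ln u else (u powr \<rho> - 1) / \<rho>)"

lemma power_kernel_deriv: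
  "u > 0 \<Longrightarrow> (power_kernel \<rho> has_real_derivative u powr (\<rho> - 1)) (at u)"
proof (cases "\<rho> = 0")
  case True
  then have eq: "power_kernel \<rho> = ln"
    by (auto simp: power_kernel_def)
  assume "u > 0" then show ?thesis
    unfolding eq using True by (auto intro!: derivative_eq_intros simp: powr_minus_divide)
next
  case False
  then have eq: "power_kernel \<rho> = (\<lambda>u. (u powr \<rho> - 1) / \<rho>)"
    by (auto simp: power_kernel_def)
  assume "u > 0" then show ?thesis
    unfolding eq using False by (auto intro!: derivative_eq_intros)
qed

lemma interval_integral_powr:
  assumes "x > 0"
  shows "(LBINT u=ereal 1..ereal x. u powr (\<rho> - 1)) = power_kernel \<rho> x"
proof -
  have pos: "u > 0" if "min 1 x \<le> u" for u
    using assms that by (auto simp: min_def split: if_splits)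
  have "(LBINT u=ereal 1..ereal x. u powr (\<rho> - 1)) = power_kernel \<rho> x - power_kernel \<rho> 1"
  proof (rule interval_integral_FTC_finite)
    show "continuous_on {min 1 x..max 1 x} (\<lambda>u. u powr (\<rho> - 1))"
      using pos by (intro continuous_intros) fastforce
    show "(power_kernel \<rho> has_vector_derivative u powr (\<rho> - 1)) (at u within {min 1 x..max 1 x})"
      if "min 1 x \<le> u" "u \<le> max 1 x" for u
      using power_kernel_deriv[OF pos[OF that(1)]]
      by (auto simp: has_real_derivative_iff_has_vector_derivative intro: has_vector_derivative_at_within)
  qed
  then show ?thesis
    by (simp add: power_kernel_def)
qed

text \<open>The inequality 1 + y \<le> exp y at \<open>y = \<rho> * ln u\<close>, divided by the
  negative number \<rho>, gives the logarithmic bound. Growth that slow, uniformly in \<rho>, is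
  what any positive power can absorb.\<close>

lemma power_kernel_bounds:
  assumes "\<rho> \<le> 0" "u \<ge> 1"
  shows "0 \<le> power_kernel \<rho> u" "power_kernel \<rho> u \<le> ln u"
proof -
  have "\<rho> * ln u + 1 \<le> u powr \<rho>"
    using assms exp_ge_add_one_self[of "\<rho> * ln u"] by (simp add: powr_def add.commute)
  moreover have "u powr \<rho> \<le> 1"
    using assms powr_mono[of \<rho> 0 u] by simp
  ultimately show "0 \<le> power_kernel \<rho> u" "power_kernel \<rho> u \<le> ln u"
    using assms by (auto simp: power_kernel_def field_simps)
qed

section \<open>Second-order Potter bound\<close>

lemma SecondRV_infty_limit:
  assumes "F \<in> SecondRV_infty \<alpha> \<rho> A" "x > 0"
  shows "((\<lambda>t. (F (t * x) / F t - x powr \<alpha>) / A t) \<longlongrightarrow> x powr \<alpha> * power_kernel \<rho> x) at_top"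
  using assms unfolding SecondRV_infty_def by (auto simp: interval_integral_powr)

text \<open>Potter-type bound: the estimate on \<open>u \<in> {1..e}\<close> is uniform by the overlap argument and is
  extended to \<open>u \<ge> 1\<close> by induction on the number of factors \<open>e\<close>; the growth of \<open>A\<close> and of
  \<open>F t * t powr - \<alpha>\<close> per step is absorbed by \<open>\<epsilon>\<close>.\<close>

lemma second_order_bound:
  fixes F A :: "real \<Rightarrow> real"
  assumes F: "F \<in> SecondRV_infty \<alpha> \<rho> A" and A: "A \<in> Aux_infty \<rho>" and \<rho>: "\<rho> \<le> 0"
    and Fpos: "\<forall>t>0. F t > 0" and \<epsilon>: "\<epsilon> > 0"
  obtains K t0 where "K > 0" "t0 > 0"
    "\<And>t u. t \<ge> t0 \<Longrightarrow> u \<ge> 1 \<Longrightarrow> \<bar>F (t * u) / F t - u powr \<alpha>\<bar> \<le> K * \<bar>A t\<bar> * u powr (\<alpha> + \<epsilon>)"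
proof -
  \<comment> \<open>Removing the power makes the ratios of \<open>f\<close> tend to 1. The overlap
    argument is then applied to \<open>f\<close> on the logarithmic scale itself, without taking
    logarithms of its values, and with the moving bound
    \<open>3 * (f t * \<bar>A t\<bar>)\<close>.\<close>
  define f where "f t = F t * t powr - \<alpha>" for t
  have fpos: "f t > 0" if "t > 0" for t
    using Fpos that by (simp add: f_def)
  have ARV: "A \<in> RV_infty \<rho>" and FRV: "F \<in> RV_infty \<alpha>"
    using A F by (auto simp: Aux_infty_def SecondRV_infty_def)
  have A0: "eventually (\<lambda>t. A t \<noteq> 0) at_top"
    by (rule RV_infty_nonzero[OF ARV])
  have f_ratio: "f (t * u) / f t = F (t * u) / F t * u powr - \<alpha>" if "t > 0" "u > 0" for t u
    using that by (simp add: f_def powr_mult)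
  define h where "h x = f (exp x)" for x
  have [measurable]: "(\<lambda>x. F (exp x)) \<in> borel_measurable borel"
    using FRV by (intro borel_measurable_exp_compose) (auto simp: RV_infty_def)
  have h: "h \<in> borel_measurable borel"
    unfolding h_def f_def by measurable

  \<comment> \<open>The overlap argument is used with \<open>T = 1\<close> and so asks for
    log-increments up to 2. There the limit is at most \<open>ln u \<le> 2\<close>, and 3 is a
    strict upper bound.\<close>
  have pointwise: "eventually (\<lambda>t. \<bar>f (t * u) - f t\<bar> \<le> 3 * (f t * \<bar>A t\<bar>)) at_top"
    if u: "1 \<le> u" "ln u \<le> 2" for u
  proof -
    have "((\<lambda>t. (F (t * u) / F t - u powr \<alpha>) / A t) \<longlongrightarrow> u powr \<alpha> * power_kernel \<rho> u) at_top"
      using F u by (intro SecondRV_infty_limit) auto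
    then have "((\<lambda>t. u powr - \<alpha> * ((F (t * u) / F t - u powr \<alpha>) / A t)) \<longlongrightarrow>
        u powr - \<alpha> * (u powr \<alpha> * power_kernel \<rho> u)) at_top"
      by (intro tendsto_intros)
    moreover have "u powr - \<alpha> * (u powr \<alpha> * power_kernel \<rho> u) = power_kernel \<rho> u"
      using u by (simp add: powr_minus)
    moreover have "\<bar>power_kernel \<rho> u\<bar> < 3"
      using power_kernel_bounds[OF \<rho> u(1)] u(2) by auto
    ultimately have "eventually (\<lambda>t. \<bar>u powr - \<alpha> * ((F (t * u) / F t - u powr \<alpha>) / A t)\<bar> < 3) at_top"
      by (intro order_tendstoD(2)[OF tendsto_rabs]) auto
    then show ?thesis
      using A0 eventually_gt_at_top[of 0]
    proof eventually_elim
      case (elim t)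
      have "u powr - \<alpha> * ((F (t * u) / F t - u powr \<alpha>) / A t) = (f (t * u) / f t - 1) / A t"
        using elim u by (simp add: f_ratio right_diff_distrib powr_minus field_simps)
      also have "\<dots> = (f (t * u) - f t) / (f t * A t)"
        using elim fpos[of t] by (simp add: field_simps)
      finally have "\<bar>(f (t * u) - f t) / (f t * A t)\<bar> < 3"
        using elim by simp
      then show ?case
        using elim fpos[of t] by (simp add: abs_mult pos_divide_less_eq)
    qed
  qed
  have "eventually (\<lambda>x. \<bar>h (x + y) - h x\<bar> \<le> 3 * (h x * \<bar>A (exp x)\<bar>)) at_top"
    if y: "0 \<le> y" "y \<le> 2 * 1" for y
    using eventually_compose_filterlim[OF pointwise[of "exp y"] exp_at_top] y
    by (simp add: h_def exp_add)
  from uniform_increment_bound[OF h _ this]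
  have ev1: "eventually (\<lambda>t. \<forall>u\<in>{0..1}. \<bar>h (ln t + u) - h (ln t)\<bar> \<le>
      3 * (h (ln t) * \<bar>A (exp (ln t))\<bar>) + 3 * (h (ln t + u) * \<bar>A (exp (ln t + u))\<bar>)) at_top"
    by (intro eventually_compose_filterlim[OF _ ln_at_top]) simp

  define e where "e = exp (1::real)"
  have e: "e > 1" by (simp add: e_def)
  obtain K1 where K1: "K1 > 0" "eventually (\<lambda>t. \<forall>u\<in>{1 / e..e}. \<bar>A (t * u) / A t\<bar> \<le> K1) at_top"
    using RV_infty_ratio_bounded[OF ARV e] .
  obtain K2 where K2: "K2 > 0" "eventually (\<lambda>t. \<forall>u\<in>{1 / e..e}. \<bar>F (t * u) / F t\<bar> \<le> K2) at_top"
    using RV_infty_ratio_bounded[OF FRV e] .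
  \<comment> \<open>The overlap bound has one term at \<open>t\<close> and one at
    \<open>t * u\<close>. The second is brought back to \<open>t\<close>: \<open>K1\<close> compares
    the values of A, \<open>K2\<close> those of F, and \<open>e powr \<bar>\<alpha>\<bar>\<close>
    bounds \<open>u powr - \<alpha>\<close> for \<open>u\<close> in \<open>{1..e}\<close>.\<close>
  define C where "C = 3 + 3 * (K2 * e powr \<bar>\<alpha>\<bar> * K1)"
  have C: "C > 0"
    using K1(1) K2(1) e by (auto simp: C_def intro!: add_pos_nonneg)
  have "eventually (\<lambda>t. \<forall>u\<in>{1..e}. \<bar>f (t * u) - f t\<bar> \<le> C * \<bar>A t\<bar> * f t) at_top"
    using ev1 K1(2) K2(2) A0 eventually_gt_at_top[of 0]
  proof eventually_elim
    case (elim t)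
    show ?case
    proof
      fix u assume u: "u \<in> {1..e}"
      then have u0: "u > 0" and lu: "ln u \<in> {0..1}"
        using ln_mono[of u e] by (auto simp: e_def)
      have ue: "u \<in> {1 / e..e}"
        using u e order_trans[of "1 / e" 1 u] by auto
      have "u powr - \<alpha> \<le> u powr \<bar>\<alpha>\<bar>"
        using u by (intro powr_mono) auto
      also have "\<dots> \<le> e powr \<bar>\<alpha>\<bar>"
        using u u0 by (intro powr_mono2) auto
      finally have pw: "u powr - \<alpha> \<le> e powr \<bar>\<alpha>\<bar>" .
      have "F (t * u) / F t \<le> K2"
        using bspec[OF elim(3) ue] abs_ge_self[of "F (t * u) / F t"] by linarith
      then have "f (t * u) / f t \<le> K2 * e powr \<bar>\<alpha>\<bar>"
        unfolding f_ratio[OF \<open>0 < t\<close> u0] using K2(1) pw by (intro mult_mono) auto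
      then have 1: "f (t * u) \<le> K2 * e powr \<bar>\<alpha>\<bar> * f t"
        using fpos[OF \<open>0 < t\<close>] by (simp add: pos_divide_le_eq)
      have "\<bar>A (t * u)\<bar> / \<bar>A t\<bar> \<le> K1"
        using bspec[OF elim(2) ue] by (simp add: abs_divide)
      then have 2: "\<bar>A (t * u)\<bar> \<le> K1 * \<bar>A t\<bar>"
        using \<open>A t \<noteq> 0\<close> by (simp add: pos_divide_le_eq)
      have "f (t * u) * \<bar>A (t * u)\<bar> \<le> (K2 * e powr \<bar>\<alpha>\<bar> * f t) * (K1 * \<bar>A t\<bar>)"
        using fpos[OF \<open>0 < t\<close>] fpos[of "t * u"] \<open>0 < t\<close> u0 K1(1) K2(1) by (intro mult_mono 1 2) auto
      moreover have "\<bar>f (t * u) - f t\<bar> \<le> 3 * (f t * \<bar>A t\<bar>) + 3 * (f (t * u) * \<bar>A (t * u)\<bar>)"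
        using bspec[OF elim(1) lu] \<open>0 < t\<close> u0 by (simp add: h_def exp_add)
      ultimately show "\<bar>f (t * u) - f t\<bar> \<le> C * \<bar>A t\<bar> * f t"
        by (simp add: C_def algebra_simps)
    qed
  qed
  \<comment> \<open>A step by the factor \<open>e\<close> costs \<open>exp \<delta>\<close> for A
    and \<open>exp \<delta>\<close> for \<open>f\<close>. With this choice their product is exp
    (\<epsilon> / 2), strictly below the gain exp \<epsilon> of
    \<open>u powr \<epsilon>\<close>.\<close>
  moreover define \<delta> where "\<delta> = \<epsilon> / 4"
  have \<delta>: "\<delta> > 0" using \<epsilon> by (simp add: \<delta>_def)
  have "eventually (\<lambda>t. \<bar>A (t * e)\<bar> \<le> exp \<delta> * \<bar>A t\<bar>) at_top"
  proof -
    have "((\<lambda>t. A (t * e) / A t) \<longlongrightarrow> e powr \<rho>) at_top"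
      using ARV e by (auto simp: RV_infty_def)
    moreover have "\<bar>e powr \<rho>\<bar> < exp \<delta>"
      using \<rho> \<delta> by (simp add: e_def powr_def)
    ultimately have "eventually (\<lambda>t. \<bar>A (t * e) / A t\<bar> < exp \<delta>) at_top"
      by (intro order_tendstoD(2)[OF tendsto_rabs])
    then show ?thesis
      using A0 by eventually_elim (simp add: abs_divide field_simps)
  qed
  moreover have "eventually (\<lambda>t. f (t * e) \<le> exp \<delta> * f t) at_top"
  proof -
    have "((\<lambda>t. F (t * e) / F t * e powr - \<alpha>) \<longlongrightarrow> e powr \<alpha> * e powr - \<alpha>) at_top"
      using FRV e by (intro tendsto_intros) (auto simp: RV_infty_def)
    moreover have "e powr \<alpha> * e powr - \<alpha> < exp \<delta>"
      using \<delta> e by (simp add: powr_minus)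
    ultimately have "eventually (\<lambda>t. F (t * e) / F t * e powr - \<alpha> < exp \<delta>) at_top"
      by (intro order_tendstoD(2))
    then show ?thesis
      using eventually_gt_at_top[of 0]
    proof eventually_elim
      case (elim t)
      then have "f (t * e) / f t < exp \<delta>"
        using f_ratio[of t e] e by simp
      then show ?case
        using fpos[of t] elim by (simp add: field_simps)
    qed
  qed
  ultimately have "eventually (\<lambda>t. t \<ge> 1 \<and> (\<forall>u\<in>{1..e}. \<bar>f (t * u) - f t\<bar> \<le> C * \<bar>A t\<bar> * f t) \<and>
      \<bar>A (t * e)\<bar> \<le> exp \<delta> * \<bar>A t\<bar> \<and> f (t * e) \<le> exp \<delta> * f t) at_top"
    by (intro eventually_conj eventually_ge_at_top)
  then obtain t0 where t0: "\<And>t. t \<ge> t0 \<Longrightarrow> t \<ge> 1"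
    "\<And>t u. t \<ge> t0 \<Longrightarrow> u \<in> {1..e} \<Longrightarrow> \<bar>f (t * u) - f t\<bar> \<le> C * \<bar>A t\<bar> * f t"
    "\<And>t. t \<ge> t0 \<Longrightarrow> \<bar>A (t * e)\<bar> \<le> exp \<delta> * \<bar>A t\<bar>"
    "\<And>t. t \<ge> t0 \<Longrightarrow> f (t * e) \<le> exp \<delta> * f t"
    unfolding eventually_at_top_linorder by blast
  \<comment> \<open>The induction step turns the constant \<open>K\<close> into
    \<open>K * exp (2 * \<delta>) + C\<close>, which must not exceed
    \<open>K * exp \<epsilon>\<close>. The quotient solves this with equality, and the extra
    \<open>C\<close> also covers the range \<open>u \<le> e\<close>.\<close>
  define K where "K = C + C / (exp \<epsilon> - exp (2 * \<delta>))"
  have gap: "exp \<epsilon> - exp (2 * \<delta>) > 0"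
    using \<delta> by (simp add: \<delta>_def)
  have K: "K \<ge> C" "K * exp (2 * \<delta>) + C \<le> K * exp \<epsilon>"
  proof -
    show "K \<ge> C" using gap C by (simp add: K_def)
    have "K * (exp \<epsilon> - exp (2 * \<delta>)) = C * (exp \<epsilon> - exp (2 * \<delta>)) + C"
      using gap by (simp add: K_def distrib_right)
    moreover have "C * (exp \<epsilon> - exp (2 * \<delta>)) \<ge> 0"
      using gap C by simp
    ultimately show "K * exp (2 * \<delta>) + C \<le> K * exp \<epsilon>"
      by (simp add: algebra_simps)
  qed
  have main: "\<bar>f (t * u) - f t\<bar> \<le> K * \<bar>A t\<bar> * f t * u powr \<epsilon>"
    if "t \<ge> t0" "1 \<le> u" "u \<le> e ^ n" for n t u
    using that
  proof (induction n arbitrary: t u)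
    case 0
    then have "u = 1" by simp
    then show ?case
      using 0 fpos[of t] t0(1)[of t] C K by simp
  next
    case (Suc n)
    have tp: "t > 0" "f t > 0"
      using t0(1)[of t] Suc.prems fpos[of t] by auto
    show ?case
    proof (cases "u \<le> e")
      case True
      have "\<bar>f (t * u) - f t\<bar> \<le> C * \<bar>A t\<bar> * f t"
        using t0(2)[of t u] True Suc.prems by simp
      also have "\<dots> \<le> K * \<bar>A t\<bar> * f t"
        using K tp by (intro mult_right_mono) auto
      also have "\<dots> \<le> K * \<bar>A t\<bar> * f t * u powr \<epsilon>"
        using K C tp Suc.prems \<epsilon> ge_one_powr_ge_zero[of u \<epsilon>]
          mult_left_mono[of 1 "u powr \<epsilon>" "K * \<bar>A t\<bar> * f t"] by simp
      finally show ?thesis .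
    next
      case False
      define v where "v = u / e"
      have v: "1 \<le> v" "v \<le> e ^ n" and u: "u = e * v"
        using False Suc.prems e by (auto simp: v_def field_simps)
      have v1: "v powr \<epsilon> \<ge> 1"
        using v \<epsilon> by (intro ge_one_powr_ge_zero) auto
      have te: "t * e \<ge> t0"
        using Suc.prems e tp mult_left_mono[of 1 e t] by linarith
      \<comment> \<open>The factor \<open>e\<close> is peeled off at the base point: the induction
        hypothesis is used at \<open>t * e\<close>, and the step from \<open>t\<close> to
        \<open>t * e\<close> is the uniform estimate on \<open>{1..e}\<close>.\<close>
      have "\<bar>f (t * e * v) - f (t * e)\<bar> \<le> K * \<bar>A (t * e)\<bar> * f (t * e) * v powr \<epsilon>"
        using te v by (rule Suc.IH)
      also have "\<dots> \<le> K * (exp \<delta> * \<bar>A t\<bar>) * (exp \<delta> * f t) * v powr \<epsilon>"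
        using t0(3,4)[OF Suc.prems(1)] K C tp e fpos[of "t * e"]
        by (intro mult_mono mult_nonneg_nonneg) auto
      also have "\<dots> = K * exp (2 * \<delta>) * (\<bar>A t\<bar> * f t * v powr \<epsilon>)"
      proof -
        have "exp (2 * \<delta>) = exp \<delta> * exp \<delta>"
          by (simp add: exp_add[symmetric])
        then show ?thesis
          by (simp only: mult_ac)
      qed
      finally have 1: "\<bar>f (t * u) - f (t * e)\<bar> \<le> K * exp (2 * \<delta>) * (\<bar>A t\<bar> * f t * v powr \<epsilon>)"
        by (simp add: u mult.assoc)
      have "\<bar>f (t * e) - f t\<bar> \<le> C * \<bar>A t\<bar> * f t"
        using t0(2)[of t e] Suc.prems e by simp
      also have "\<dots> \<le> C * (\<bar>A t\<bar> * f t * v powr \<epsilon>)"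
        using C tp v1 mult_left_mono[of 1 "v powr \<epsilon>" "C * \<bar>A t\<bar> * f t"] by (simp add: mult.assoc)
      finally have "\<bar>f (t * u) - f t\<bar> \<le> (K * exp (2 * \<delta>) + C) * (\<bar>A t\<bar> * f t * v powr \<epsilon>)"
        using 1 by (simp add: algebra_simps)
      also have "\<dots> \<le> K * exp \<epsilon> * (\<bar>A t\<bar> * f t * v powr \<epsilon>)"
        using K(2) tp by (intro mult_right_mono) auto
      also have "exp \<epsilon> = e powr \<epsilon>"
        by (simp add: e_def powr_def)
      also have "K * e powr \<epsilon> * (\<bar>A t\<bar> * f t * v powr \<epsilon>) = K * \<bar>A t\<bar> * f t * u powr \<epsilon>"
        using e v by (simp add: u powr_mult)
      finally show ?thesis .
    qed
  qed
  show ?thesis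
  proof (rule that[of K "max t0 1"])
    show "K > 0" using K C by simp
    show "max t0 1 > 0" by simp
    fix t u :: real assume t: "t \<ge> max t0 1" and u: "u \<ge> 1"
    obtain n where "u < e ^ n"
      using real_arch_pow[OF e] by blast
    then have "\<bar>f (t * u) - f t\<bar> \<le> K * \<bar>A t\<bar> * f t * u powr \<epsilon>"
      using main[of t u n] t u by simp
    then have "\<bar>f (t * u) - f t\<bar> / f t \<le> K * \<bar>A t\<bar> * u powr \<epsilon>"
      using fpos[of t] t by (simp add: pos_divide_le_eq mult_ac)
    moreover have "\<bar>f (t * u) - f t\<bar> / f t = \<bar>f (t * u) / f t - 1\<bar>"
    proof -
      have "f (t * u) / f t - 1 = (f (t * u) - f t) / f t"
        using fpos[of t] t by (simp add: diff_divide_distrib)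
      then show ?thesis
        using fpos[of t] t by (simp only: abs_divide) simp
    qed
    ultimately have "u powr \<alpha> * \<bar>f (t * u) / f t - 1\<bar> \<le> u powr \<alpha> * (K * \<bar>A t\<bar> * u powr \<epsilon>)"
      by (intro mult_left_mono) auto
    moreover have "u powr \<alpha> * \<bar>f (t * u) / f t - 1\<bar> = \<bar>u powr \<alpha> * (f (t * u) / f t - 1)\<bar>"
      by (simp add: abs_mult)
    moreover have "u powr \<alpha> * (f (t * u) / f t - 1) = F (t * u) / F t - u powr \<alpha>"
      using t u by (simp add: f_ratio right_diff_distrib powr_minus)
    ultimately show "\<bar>F (t * u) / F t - u powr \<alpha>\<bar> \<le> K * \<bar>A t\<bar> * u powr (\<alpha> + \<epsilon>)"
      by (simp add: powr_add algebra_simps)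
  qed
qed

subsection \<open>Sufficiency of the representation\<close>

lemma set_integral_scale:
  fixes g :: "real \<Rightarrow> real"
  assumes "t > 0"
  shows "(LBINT s:S. g s) = t * (LBINT u:{u. t * u \<in> S}. g (t * u))"
  using assms unfolding set_lebesgue_integral_def
  by (subst lborel_integral_real_affine[of t _ 0]) (auto simp: indicator_def)

text \<open>Turns a function that is controlled only on the positive half-line into a Borel function
  on the line, with the same integrals over positive sets.\<close>

lemma borel_measurable_extend_zero:
  fixes F :: "real \<Rightarrow> real"
  assumes "F \<in> borel_measurable (restrict_space borel S)" "S \<in> sets borel"
  shows "(\<lambda>s. if s \<in> S then F s else 0) \<in> borel_measurable borel"
proof -
  have "(\<lambda>s. if s \<in> S then F s else 0) = (\<lambda>s. indicator S s *\<^sub>R F s)"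
    by auto
  then show ?thesis
    using assms by (simp add: borel_measurable_restrict_space_iff)
qed

text \<open>The substitution s = t u turns the quotient into the integral of (B(tu) / B(t)) / u over
  the fixed interval (a, b). The integrand converges pointwise to u^(rho-1), and the local uniform
  bound on the ratio gives the constant majorant K / a.\<close>

lemma RV_infty_set_integral_limit:
  fixes B :: "real \<Rightarrow> real"
  assumes B: "B \<in> RV_infty \<rho>" and ab: "0 < a"
  shows "((\<lambda>t. (LBINT s:{t * a<..<t * b}. B s / s) / B t) \<longlongrightarrow>
    (LBINT u:{a<..<b}. u powr (\<rho> - 1))) at_top"
proof -
  \<comment> \<open>Dominated convergence asks for measurability of the integrand at every
    \<open>t\<close>, including those where \<open>t * u\<close> is not positive.\<close>
  define B0 where "B0 s = (if s \<in> {0<..} then B s else 0)" for s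
  have [measurable]: "B0 \<in> borel_measurable borel"
    using B unfolding B0_def by (intro borel_measurable_extend_zero) (auto simp: RV_infty_def)
  \<comment> \<open>Chosen so that \<open>{a<..<b}\<close> lies inside
    \<open>{1 / X..X}\<close>.\<close>
  define X where "X = 1 / a + \<bar>b\<bar> + 1"
  have X: "X > 1" "b < X" "1 / X < a"
  proof -
    show "X > 1" "b < X"
      using ab abs_ge_self[of b] divide_pos_pos[of 1 a] unfolding X_def by linarith+
    have "1 / a < X"
      by (simp add: X_def)
    then have "1 < X * a"
      using ab by (simp add: pos_divide_less_eq)
    then show "1 / X < a"
      using \<open>X > 1\<close> by (simp add: pos_divide_less_eq mult.commute)
  qed
  obtain K where K: "K > 0" "eventually (\<lambda>t. \<forall>u\<in>{1 / X..X}. \<bar>B (t * u) / B t\<bar> \<le> K) at_top"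
    using RV_infty_ratio_bounded[OF B X(1)] .
  have "((\<lambda>t. LBINT u. indicator {a<..<b} u *\<^sub>R (B0 (t * u) / B t / u)) \<longlongrightarrow>
      (LBINT u. indicator {a<..<b} u *\<^sub>R (u powr (\<rho> - 1)))) at_top"
  proof (rule integral_dominated_convergence_at_top)
    show "(\<lambda>u. indicator {a<..<b} u *\<^sub>R (u powr (\<rho> - 1))) \<in> borel_measurable lborel"
      by measurable
    show "(\<lambda>u. indicator {a<..<b} u *\<^sub>R (B0 (t * u) / B t / u)) \<in> borel_measurable lborel" for t
      by measurable
    show "integrable lborel (\<lambda>u. indicator {a<..<b} u *\<^sub>R (K / a))"
      using emeasure_bounded_finite[of "{a<..<b}"]
      by (intro integrable_scaleR_left integrable_real_indicator) auto
    show "AE u in lborel. ((\<lambda>t. indicator {a<..<b} u *\<^sub>R (B0 (t * u) / B t / u)) \<longlongrightarrow>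
        indicator {a<..<b} u *\<^sub>R (u powr (\<rho> - 1))) at_top"
    proof (rule AE_I2)
      fix u :: real
      show "((\<lambda>t. indicator {a<..<b} u *\<^sub>R (B0 (t * u) / B t / u)) \<longlongrightarrow>
        indicator {a<..<b} u *\<^sub>R (u powr (\<rho> - 1))) at_top"
      proof (cases "u \<in> {a<..<b}")
        case True
        then have u: "u > 0" using ab by auto
        have "((\<lambda>t. B (t * u) / B t / u) \<longlongrightarrow> u powr \<rho> / u) at_top"
          using B u by (intro tendsto_intros) (auto simp: RV_infty_def)
        moreover have "eventually (\<lambda>t. B (t * u) / B t / u = B0 (t * u) / B t / u) at_top"
          using eventually_gt_at_top[of 0] by eventually_elim (simp add: B0_def u)
        ultimately have "((\<lambda>t. B0 (t * u) / B t / u) \<longlongrightarrow> u powr \<rho> / u) at_top"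
          by (rule Lim_transform_eventually)
        then show ?thesis
          using True u by (simp add: powr_diff)
      qed simp
    qed
    show "eventually (\<lambda>t. AE u in lborel. norm (indicator {a<..<b} u *\<^sub>R (B0 (t * u) / B t / u))
        \<le> indicator {a<..<b} u *\<^sub>R (K / a)) at_top"
      using K(2) eventually_gt_at_top[of 0]
    proof eventually_elim
      case (elim t)
      have "\<bar>B0 (t * u) / B t / u\<bar> \<le> K / a" if u: "u \<in> {a<..<b}" for u
      proof -
        have "\<bar>B (t * u) / B t\<bar> \<le> K"
          using u X by (intro bspec[OF elim(1)]) auto
        then have "\<bar>B (t * u) / B t\<bar> / u \<le> K / a"
          using u ab K(1) by (intro frac_le) auto
        then show ?thesis
          using u ab elim(2) by (simp add: B0_def abs_divide abs_mult)
      qed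
      then show ?case
        by (intro AE_I2) (simp split: split_indicator)
    qed
  qed
  moreover have "eventually (\<lambda>t. (LBINT u. indicator {a<..<b} u *\<^sub>R (B0 (t * u) / B t / u)) =
      (LBINT s:{t * a<..<t * b}. B s / s) / B t) at_top"
    using eventually_gt_at_top[of 0]
  proof eventually_elim
    case (elim t)
    have "{u. t * u \<in> {t * a<..<t * b}} = {a<..<b}"
      using elim by auto
    then have "(LBINT s:{t * a<..<t * b}. B s / s) = t * (LBINT u:{a<..<b}. B (t * u) / (t * u))"
      using set_integral_scale[OF elim, of "{t * a<..<t * b}" "\<lambda>s. B s / s"] by simp
    also have "\<dots> / B t = (LBINT u:{a<..<b}. t * (B (t * u) / (t * u)) / B t)"
      by (simp only: set_integral_divide_zero set_integral_mult_right)
    also have "\<dots> = (LBINT u:{a<..<b}. B0 (t * u) / B t / u)"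
      using elim ab by (intro set_lebesgue_integral_cong) (auto simp: B0_def)
    finally show ?case
      by (simp add: set_lebesgue_integral_def)
  qed
  ultimately show ?thesis
    unfolding set_lebesgue_integral_def by (rule Lim_transform_eventually)
qed

lemma RV_infty_interval_integral_limit:
  assumes B: "B \<in> RV_infty \<rho>" and x: "x > 0"
  shows "((\<lambda>t. (LBINT s=ereal t..ereal (t * x). B s / s) / B t) \<longlongrightarrow> power_kernel \<rho> x) at_top"
proof (cases "x \<ge> 1")
  case True
  have "((\<lambda>t. (LBINT s:{t * 1<..<t * x}. B s / s) / B t) \<longlongrightarrow> power_kernel \<rho> x) at_top"
    using RV_infty_set_integral_limit[OF B, of 1 x] interval_integral_powr[OF x, of \<rho>] True
    by (simp add: interval_lebesgue_integral_le_eq)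
  moreover have "eventually (\<lambda>t. (LBINT s:{t * 1<..<t * x}. B s / s) / B t =
      (LBINT s=ereal t..ereal (t * x). B s / s) / B t) at_top"
    using eventually_gt_at_top[of 0]
    by eventually_elim (use True in \<open>simp add: interval_lebesgue_integral_le_eq\<close>)
  ultimately show ?thesis
    by (rule Lim_transform_eventually)
next
  case False
  have "((\<lambda>t. - ((LBINT s:{t * x<..<t * 1}. B s / s) / B t)) \<longlongrightarrow>
      - (LBINT u:{x<..<1}. u powr (\<rho> - 1))) at_top"
    by (intro tendsto_minus RV_infty_set_integral_limit[OF B x])
  moreover have "- (LBINT u:{x<..<1}. u powr (\<rho> - 1)) = power_kernel \<rho> x"
    using interval_integral_powr[OF x, of \<rho>] False by (simp add: interval_lebesgue_integral_gt_eq)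
  moreover have "eventually (\<lambda>t. - ((LBINT s:{t * x<..<t * 1}. B s / s) / B t) =
      (LBINT s=ereal t..ereal (t * x). B s / s) / B t) at_top"
    using eventually_gt_at_top[of 0]
    by eventually_elim (use False in \<open>simp add: interval_lebesgue_integral_gt_eq\<close>)
  ultimately show ?thesis
    by (auto intro: Lim_transform_eventually)
qed

lemma exp_quotient_tendsto:
  fixes D B :: "real \<Rightarrow> real"
  assumes "((\<lambda>t. D t / B t) \<longlongrightarrow> k) at_top" "(B \<longlongrightarrow> 0) at_top" "eventually (\<lambda>t. B t \<noteq> 0) at_top"
  shows "(D \<longlongrightarrow> 0) at_top" "((\<lambda>t. (exp (D t) - 1) / B t) \<longlongrightarrow> k) at_top"
proof -
  have "((\<lambda>t. D t / B t * B t) \<longlongrightarrow> k * 0) at_top"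
    by (intro tendsto_mult assms)
  moreover have "eventually (\<lambda>t. D t / B t * B t = D t) at_top"
    using assms(3) by eventually_elim simp
  ultimately have "(D \<longlongrightarrow> k * 0) at_top"
    by (rule Lim_transform_eventually)
  then show D: "(D \<longlongrightarrow> 0) at_top"
    by simp
  \<comment> \<open>The continuous extension of (exp y - 1) / y to 0 keeps the factorization valid
    at those \<open>t\<close> where \<open>D t = 0\<close>.\<close>
  define \<phi> where "\<phi> y = (if y = 0 then 1 else (exp y - 1) / y)" for y :: real
  have "(\<phi> \<longlongrightarrow> 1) (at 0)"
    using DERIV_exp[of "0::real", unfolded has_field_derivative_iff, simplified]
    by (rule Lim_transform_eventually) (auto simp: \<phi>_def eventually_at_filter)
  then have "isCont \<phi> 0"
    by (simp add: isCont_def \<phi>_def)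
  then have "((\<lambda>t. \<phi> (D t)) \<longlongrightarrow> \<phi> 0) at_top"
    using D by (rule isCont_tendsto_compose)
  then have "((\<lambda>t. \<phi> (D t) * (D t / B t)) \<longlongrightarrow> 1 * k) at_top"
    by (intro tendsto_mult assms) (simp add: \<phi>_def)
  moreover have "\<phi> (D t) * (D t / B t) = (exp (D t) - 1) / B t" for t
    by (simp add: \<phi>_def)
  ultimately show "((\<lambda>t. (exp (D t) - 1) / B t) \<longlongrightarrow> k) at_top"
    by (simp only: mult_1)
qed

section \<open>From the representation to second-order regular variation\<close>

text \<open>By the representation F(tx) / F(t) = x^alpha R exp(D), where R is the quotient of the
  two factors 1 + zeta2 B and D is the integral of B(s)/s from t to tx. Divided by B(t), R - 1
  contributes zeta2 (x^rho - 1) and exp(D) - 1 contributes the kernel. Their sum is (rho zeta2 + 1)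
  times the kernel, and B / A cancels exactly this factor.\<close>

lemma representation_imp_SecondRV:
  fixes F A :: "real \<Rightarrow> real"
  assumes meas: "F \<in> borel_measurable (restrict_space borel {0<..})"
    and Fpos: "\<forall>t>0. F t > 0" and A: "A \<in> Aux_infty \<rho>"
    and rep: "second_order_representation F \<alpha> \<rho> A \<zeta>\<^sub>1 \<zeta>\<^sub>2 B"
  shows "F \<in> SecondRV_infty \<alpha> \<rho> A"
proof -
  have ARV: "A \<in> RV_infty \<rho>" and A0: "(A \<longlongrightarrow> 0) at_top"
    using A by (auto simp: Aux_infty_def)
  have BRV: "B \<in> RV_infty \<rho>" and B0: "(B \<longlongrightarrow> 0) at_top"
    using rep by (auto simp: second_order_representation_def Aux_infty_def)
  have \<zeta>: "\<zeta>\<^sub>1 \<noteq> 0" and m: "\<rho> * \<zeta>\<^sub>2 + 1 > 0"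
    and lim_AB: "((\<lambda>t. A t / B t) \<longlongrightarrow> \<rho> * \<zeta>\<^sub>2 + 1) at_top"
    and int: "\<And>t. t > 0 \<Longrightarrow> interval_lebesgue_integrable lborel (ereal 1) (ereal t) (\<lambda>s. B s / s)"
    and Feq: "\<And>t. t > 0 \<Longrightarrow>
        F t = \<zeta>\<^sub>1 * (1 + \<zeta>\<^sub>2 * B t) * exp (LBINT s=ereal 1..ereal t. B s / s) * t powr \<alpha>"
    using rep by (auto simp: second_order_representation_def)
  note A_nz = RV_infty_nonzero[OF ARV] and B_nz = RV_infty_nonzero[OF BRV]
  have lim: "((\<lambda>t. (F (t * x) / F t - x powr \<alpha>) / A t) \<longlongrightarrow> x powr \<alpha> * power_kernel \<rho> x) at_top"
    if x: "x > 0" for x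
  proof -
    define D where "D t = (LBINT s=ereal t..ereal (t * x). B s / s)" for t
    have D: "((\<lambda>t. D t / B t) \<longlongrightarrow> power_kernel \<rho> x) at_top"
      unfolding D_def by (rule RV_infty_interval_integral_limit[OF BRV x])
    note ED = exp_quotient_tendsto[OF D B0 B_nz]
    have "((\<lambda>t. inverse (A t / B t)) \<longlongrightarrow> inverse (\<rho> * \<zeta>\<^sub>2 + 1)) at_top"
      using m by (intro tendsto_inverse lim_AB) auto
    then have BA: "((\<lambda>t. B t / A t) \<longlongrightarrow> inverse (\<rho> * \<zeta>\<^sub>2 + 1)) at_top"
      by simp
    have r: "((\<lambda>t. B (t * x) / B t) \<longlongrightarrow> x powr \<rho>) at_top"
      using BRV x by (auto simp: RV_infty_def)
    have L: "((\<lambda>t. x powr \<alpha> * (B t / A t) *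
          (\<zeta>\<^sub>2 * (B (t * x) / B t - 1) / (1 + \<zeta>\<^sub>2 * B t) * exp (D t) + (exp (D t) - 1) / B t)) \<longlongrightarrow>
        x powr \<alpha> * inverse (\<rho> * \<zeta>\<^sub>2 + 1) *
          (\<zeta>\<^sub>2 * (x powr \<rho> - 1) / (1 + \<zeta>\<^sub>2 * 0) * exp 0 + power_kernel \<rho> x)) at_top"
      by (intro tendsto_intros BA r B0 ED) auto
    have L_eq: "x powr \<alpha> * inverse (\<rho> * \<zeta>\<^sub>2 + 1) *
        (\<zeta>\<^sub>2 * (x powr \<rho> - 1) / (1 + \<zeta>\<^sub>2 * 0) * exp 0 + power_kernel \<rho> x) = x powr \<alpha> * power_kernel \<rho> x"
    proof -
      have "x powr \<rho> - 1 = \<rho> * power_kernel \<rho> x"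
        using x by (simp add: power_kernel_def)
      then have "\<zeta>\<^sub>2 * (x powr \<rho> - 1) + power_kernel \<rho> x = (\<rho> * \<zeta>\<^sub>2 + 1) * power_kernel \<rho> x"
        by (simp add: algebra_simps)
      then show ?thesis
        using m by simp
    qed
    have ev: "eventually (\<lambda>t. x powr \<alpha> * (B t / A t) *
          (\<zeta>\<^sub>2 * (B (t * x) / B t - 1) / (1 + \<zeta>\<^sub>2 * B t) * exp (D t) + (exp (D t) - 1) / B t)
        = (F (t * x) / F t - x powr \<alpha>) / A t) at_top"
      \<comment> \<open>Beyond this threshold both \<open>t\<close> and \<open>t * x\<close> are at
        least 1, so a single integrability instance, from 1 to the larger of them, covers all three
        integrals.\<close>
      using A_nz B_nz eventually_ge_at_top[of "max 1 (1 / x)"]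
    proof eventually_elim
      case (elim t)
      then have t: "t \<ge> 1" "t * x \<ge> 1"
        using x by (auto simp: field_simps)
      have "(LBINT s=ereal 1..ereal t. B s / s) + D t = (LBINT s=ereal 1..ereal (t * x). B s / s)"
        unfolding D_def
      proof (rule interval_integral_sum)
        have "min (ereal 1) (min (ereal t) (ereal (t * x))) = ereal 1"
          "max (ereal 1) (max (ereal t) (ereal (t * x))) = ereal (max t (t * x))"
          using t by (auto simp: min_def max_def)
        then show "interval_lebesgue_integrable lborel (min (ereal 1) (min (ereal t) (ereal (t * x))))
            (max (ereal 1) (max (ereal t) (ereal (t * x)))) (\<lambda>s. B s / s)"
          using int[of "max t (t * x)"] t by simp
      qed
      then have E: "exp (LBINT s=ereal 1..ereal (t * x). B s / s) =
          exp (LBINT s=ereal 1..ereal t. B s / s) * exp (D t)"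
        by (metis exp_add)
      have "F t > 0"
        using Fpos t by simp
      have Ft: "F t = \<zeta>\<^sub>1 * (1 + \<zeta>\<^sub>2 * B t) * exp (LBINT s=ereal 1..ereal t. B s / s) * t powr \<alpha>"
        using Feq[of t] t by simp
      then have nz: "1 + \<zeta>\<^sub>2 * B t \<noteq> 0"
        using \<open>F t > 0\<close> by auto
      have "F (t * x) = \<zeta>\<^sub>1 * (1 + \<zeta>\<^sub>2 * B (t * x)) *
          (exp (LBINT s=ereal 1..ereal t. B s / s) * exp (D t)) * (t powr \<alpha> * x powr \<alpha>)"
        using Feq[of "t * x"] t x by (simp add: E powr_mult)
      moreover define R where "R = (1 + \<zeta>\<^sub>2 * B (t * x)) / (1 + \<zeta>\<^sub>2 * B t)"
      ultimately have quot: "F (t * x) / F t = R * exp (D t) * x powr \<alpha>"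
        using Ft \<zeta> nz t by simp
      have "\<zeta>\<^sub>2 * (B (t * x) / B t - 1) / (1 + \<zeta>\<^sub>2 * B t) = (R - 1) / B t"
        using elim nz by (simp add: R_def field_simps)
      moreover have "(R - 1) / B t * exp (D t) + (exp (D t) - 1) / B t = (R * exp (D t) - 1) / B t"
        by (simp add: add_divide_distrib[symmetric] algebra_simps)
      moreover have "x powr \<alpha> * (B t / A t) * ((R * exp (D t) - 1) / B t) =
          (R * exp (D t) * x powr \<alpha> - x powr \<alpha>) / A t"
      proof -
        have "x powr \<alpha> * (B t / A t) * (w / B t) = x powr \<alpha> * w / A t" for w
          using \<open>B t \<noteq> 0\<close> by simp
        note this[of "R * exp (D t) - 1"]
        also have "x powr \<alpha> * (R * exp (D t) - 1) = R * exp (D t) * x powr \<alpha> - x powr \<alpha>"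
          by (simp add: algebra_simps)
        finally show ?thesis .
      qed
      ultimately show ?case
        by (simp only: quot)
    qed
    show ?thesis
      using Lim_transform_eventually[OF L ev] unfolding L_eq .
  qed
  \<comment> \<open>First-order regular variation follows from the second-order limit, since
    multiplying it by A, which tends to 0, kills the deviation from
    \<open>x powr \<alpha>\<close>.\<close>
  have "((\<lambda>t. F (t * x) / F t) \<longlongrightarrow> x powr \<alpha>) at_top" if x: "x > 0" for x
  proof -
    have "((\<lambda>t. (F (t * x) / F t - x powr \<alpha>) / A t * A t + x powr \<alpha>) \<longlongrightarrow>
        x powr \<alpha> * power_kernel \<rho> x * 0 + x powr \<alpha>) at_top"
      by (intro tendsto_intros lim[OF x] A0)
    moreover have "eventually (\<lambda>t. (F (t * x) / F t - x powr \<alpha>) / A t * A t + x powr \<alpha> = F (t * x) / F t) at_top"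
      using A_nz by eventually_elim simp
    ultimately have "((\<lambda>t. F (t * x) / F t) \<longlongrightarrow> x powr \<alpha> * power_kernel \<rho> x * 0 + x powr \<alpha>) at_top"
      by (rule Lim_transform_eventually)
    then show ?thesis
      by simp
  qed
  moreover have "eventually (\<lambda>t. F t > 0) at_top"
    using eventually_gt_at_top[of 0] by eventually_elim (use Fpos in auto)
  ultimately have "F \<in> RV_infty \<alpha>"
    using meas by (auto simp: RV_infty_def constant_sign_near_infinity_def)
  then show ?thesis
    using lim ARV unfolding SecondRV_infty_def RV_infty_def by (auto simp: interval_integral_powr)
qed

subsection \<open>Tail integrals\<close>

text \<open>Half of the decay, \<open>u powr - (c / 2)\<close>, absorbs the logarithmic growth of
  the kernel. This is the boundary term at infinity in the integration by parts below.\<close>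

lemma powr_mult_power_kernel_tendsto_0:
  assumes "c > 0" "\<rho> \<le> 0"
  shows "((\<lambda>u. u powr - c * power_kernel \<rho> u) \<longlongrightarrow> 0) at_top"
proof (rule Lim_null_comparison)
  show "eventually (\<lambda>u. norm (u powr - c * power_kernel \<rho> u) \<le> u powr - (c / 2) / (c / 2)) at_top"
    using eventually_ge_at_top[of 1]
  proof eventually_elim
    case (elim u)
    have "power_kernel \<rho> u \<le> u powr (c / 2) / (c / 2)"
      using power_kernel_bounds(2)[OF assms(2) elim] ln_powr_bound[OF elim, of "c / 2"] assms(1) by simp
    then have "u powr - c * power_kernel \<rho> u \<le> u powr - c * (u powr (c / 2) / (c / 2))"
      by (intro mult_left_mono) auto
    also have "\<dots> = u powr - (c / 2) / (c / 2)"
      using powr_add[of u "- c" "c / 2"] by simp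
    finally show ?case
      using power_kernel_bounds(1)[OF assms(2) elim] by (simp add: abs_mult)
  qed
  have "((\<lambda>u. u powr - (c / 2) / (c / 2)) \<longlongrightarrow> 0 / (c / 2)) at_top"
    using assms(1) by (intro tendsto_intros tendsto_neg_powr filterlim_ident) auto
  then show "((\<lambda>u. u powr - (c / 2) / (c / 2)) \<longlongrightarrow> 0) at_top"
    by simp
qed

lemma powr_tail_integral:
  fixes a c :: real
  assumes "a > 0" "c > 0"
  shows "set_integrable lborel {a<..} (\<lambda>u. u powr (- c - 1))"
    and "(LBINT u:{a<..}. u powr (- c - 1)) = a powr - c / c"
proof -
  define G where "G u = - (u powr - c / c)" for u
  have deriv: "(G has_real_derivative u powr (- c - 1)) (at u)" if "u > 0" for u
    unfolding G_def using that assms by (auto intro!: derivative_eq_intros simp: powr_diff)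
  have lim_a: "((G \<circ> real_of_ereal) \<longlongrightarrow> G a) (at_right (ereal a))"
  proof -
    have "(G \<longlongrightarrow> G a) (at_right a)"
      using DERIV_isCont[OF deriv[of a]] assms(1) unfolding isCont_def by (auto intro: tendsto_within_subset)
    then show ?thesis by (simp add: ereal_tendsto_simps)
  qed
  have "((\<lambda>u. - (u powr - c / c)) \<longlongrightarrow> - (0 / c)) at_top"
    using assms(2) by (intro tendsto_intros tendsto_neg_powr filterlim_ident) auto
  then have lim_inf: "((G \<circ> real_of_ereal) \<longlongrightarrow> 0) (at_left \<infinity>)"
    unfolding ereal_tendsto_simps G_def by simp
  have G_deriv: "(G has_real_derivative u powr (- c - 1)) (at u)" if "ereal a < ereal u" for u
    using that assms by (intro deriv) auto
  have isCont_powr: "isCont (\<lambda>u. u powr (- c - 1)) u" if "ereal a < ereal u" for u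
    using that assms by (intro continuous_intros) auto
  have nonneg: "AE u in lborel. ereal a < ereal u \<longrightarrow> ereal u < \<infinity> \<longrightarrow> 0 \<le> u powr (- c - 1)"
    by simp
  have "ereal a < \<infinity>" by simp
  note FTC = interval_integral_FTC_nonneg[OF this G_deriv isCont_powr nonneg lim_a lim_inf]
  have "set_integrable lborel (einterval (ereal a) \<infinity>) (\<lambda>u. u powr (- c - 1))"
    "(LBINT u=ereal a..\<infinity>. u powr (- c - 1)) = 0 - G a"
    by (rule FTC(1); assumption) (rule FTC(2); assumption)
  then show "set_integrable lborel {a<..} (\<lambda>u. u powr (- c - 1))"
    "(LBINT u:{a<..}. u powr (- c - 1)) = a powr - c / c"
    by (auto simp: G_def interval_integral_to_infinity_eq)
qed

text \<open>Integration by parts: \<open>G\<close> collects the boundary term with u^(-c) / c and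
  the antiderivative of the remaining u^(rho-c-1) / c. The kernel vanishes at 1, so only the second
  summand of \<open>G 1\<close> survives.\<close>

lemma power_kernel_tail_integral:
  assumes c: "c > 0" and \<rho>: "\<rho> \<le> 0"
  shows "(LBINT u:{1<..}. u powr (- c - 1) * power_kernel \<rho> u) = 1 / (c * (c - \<rho>))"
proof -
  define G where "G u = - (u powr - c * power_kernel \<rho> u / c + u powr (\<rho> - c) / (c * (c - \<rho>)))" for u
  have deriv: "(G has_real_derivative u powr (- c - 1) * power_kernel \<rho> u) (at u)" if "u > 0" for u
  proof -
    have powr: "((\<lambda>u. u powr r) has_real_derivative r * u powr (r - 1)) (at u)" for r
      using that by (rule has_real_derivative_powr)
    have "(G has_real_derivative - ((- c * u powr (- c - 1) * power_kernel \<rho> u + u powr (\<rho> - 1) * u powr - c) / c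
        + (\<rho> - c) * u powr (\<rho> - c - 1) / (c * (c - \<rho>)))) (at u)"
      unfolding G_def
      by (intro DERIV_minus DERIV_add DERIV_cdivide DERIV_mult powr power_kernel_deriv that)
    moreover have "u powr (\<rho> - 1) * u powr - c = u powr (\<rho> - c - 1)"
      by (simp add: powr_add[symmetric] algebra_simps)
    moreover have "(\<rho> - c) * u powr (\<rho> - c - 1) / (c * (c - \<rho>)) = - (u powr (\<rho> - c - 1) / c)"
    proof -
      have "\<rho> - c = - (c - \<rho>)" "c - \<rho> \<noteq> 0"
        using c \<rho> by auto
      then show ?thesis
        by (simp only: minus_mult_left[symmetric] minus_divide_left[symmetric]) simp
    qed
    ultimately show ?thesis
      using c by (simp add: field_simps)
  qed
  have lim_1: "((G \<circ> real_of_ereal) \<longlongrightarrow> G 1) (at_right (ereal 1))"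
  proof -
    have "(G \<longlongrightarrow> G 1) (at_right 1)"
      using DERIV_isCont[OF deriv[of 1]] unfolding isCont_def by (auto intro: tendsto_within_subset)
    then show ?thesis by (simp only: ereal_tendsto_simps)
  qed
  have "((\<lambda>u. - (u powr - c * power_kernel \<rho> u / c + u powr (\<rho> - c) / (c * (c - \<rho>))))
      \<longlongrightarrow> - (0 / c + 0 / (c * (c - \<rho>)))) at_top"
    using c \<rho> by (intro tendsto_intros powr_mult_power_kernel_tendsto_0 tendsto_neg_powr filterlim_ident) auto
  then have lim_inf: "((G \<circ> real_of_ereal) \<longlongrightarrow> 0) (at_left \<infinity>)"
    unfolding ereal_tendsto_simps G_def by simp
  have "(LBINT u=ereal 1..\<infinity>. u powr (- c - 1) * power_kernel \<rho> u) = 0 - G 1"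
  proof (rule interval_integral_FTC_nonneg(2)[OF _ deriv _ _ lim_1 lim_inf])
    show "isCont (\<lambda>u. u powr (- c - 1) * power_kernel \<rho> u) u" if "ereal 1 < ereal u" for u
    proof (rule isCont_mult)
      have "u > 0" using that by simp
      then show "isCont (power_kernel \<rho>) u"
        by (rule DERIV_isCont[OF power_kernel_deriv])
      show "isCont (\<lambda>u. u powr (- c - 1)) u"
        using \<open>u > 0\<close> by (intro continuous_intros) auto
    qed
    show "AE u in lborel. ereal 1 < ereal u \<longrightarrow> ereal u < \<infinity> \<longrightarrow> 0 \<le> u powr (- c - 1) * power_kernel \<rho> u"
      using power_kernel_bounds(1)[OF \<rho>] by auto
  qed auto
  then show ?thesis
    by (simp add: G_def interval_integral_to_infinity_eq power_kernel_def)
qed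

section \<open>Logarithm of a tail integral\<close>

lemma tendsto_mult_abs_diff_0: "((\<lambda>y. C * \<bar>y - x\<bar>) \<longlongrightarrow> 0) (at (x::real))" for C :: real
proof -
  have "((\<lambda>y. C * \<bar>y - x\<bar>) \<longlongrightarrow> C * \<bar>x - x\<bar>) (at x)"
    by (intro tendsto_intros)
  then show ?thesis by simp
qed

lemma interval_integral_open_add:
  fixes q :: "real \<Rightarrow> real"
  assumes q: "\<And>l u. 0 < l \<Longrightarrow> l \<le> u \<Longrightarrow> set_integrable lborel {l<..<u} q" and ab: "0 < a" "a \<le> b"
  shows "(LBINT s=ereal 1..ereal b. q s) - (LBINT s=ereal 1..ereal a. q s) = (LBINT s:{a<..<b}. q s)"
proof -
  define l u where "l = min 1 a" and "u = max 1 b"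
  have lu: "0 < l" "l \<le> u"
    using ab by (auto simp: l_def u_def)
  have "min (ereal 1) (min (ereal a) (ereal b)) = ereal l" "max (ereal 1) (max (ereal a) (ereal b)) = ereal u"
    using ab by (auto simp: l_def u_def min_def max_def)
  then have "(LBINT s=ereal 1..ereal a. q s) + (LBINT s=ereal a..ereal b. q s) = (LBINT s=ereal 1..ereal b. q s)"
    using q[OF lu] lu by (intro interval_integral_sum) (simp add: interval_lebesgue_integrable_def)
  then show ?thesis
    using ab by (simp add: interval_lebesgue_integral_le_eq)
qed

text \<open>The integrand is only measurable, so the fundamental theorem of calculus does not apply
  directly; instead \<open>\<integral>p / I + ln I\<close> has quadratically small increments, hence zero derivative.\<close>

lemma integral_over_tail_integral:
  fixes p :: "real \<Rightarrow> real"
  defines "I \<equiv> \<lambda>t. LBINT s:{t<..}. p s"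
  assumes p [measurable]: "p \<in> borel_measurable borel" and p0: "\<And>s. p s \<ge> 0"
    and bdd: "\<And>l u. 0 < l \<Longrightarrow> l \<le> u \<Longrightarrow> \<exists>C. \<forall>s\<in>{l..u}. p s \<le> C"
    and int: "\<And>t. t > 0 \<Longrightarrow> set_integrable lborel {t<..} p"
    and pos: "\<And>t. t > 0 \<Longrightarrow> I t > 0"
  shows "continuous_on {0<..} I"
    and "0 < l \<Longrightarrow> l \<le> u \<Longrightarrow> set_integrable lborel {l<..<u} (\<lambda>s. p s / I s)"
    and "t > 0 \<Longrightarrow> (LBINT s=ereal 1..ereal t. p s / I s) = ln (I 1) - ln (I t)"
proof -
  have I_diff: "I a - I b = (LBINT s:{a<..<b}. p s)" if "0 < a" "a \<le> b" for a b
  proof -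
    have "(LBINT s=ereal a..ereal b. p s) + (LBINT s=ereal b..\<infinity>. p s) = (LBINT s=ereal a..\<infinity>. p s)"
      using that int[of a]
      by (intro interval_integral_sum) (auto simp: interval_lebesgue_integrable_def min_def max_def)
    then show ?thesis
      using that by (simp add: I_def interval_lebesgue_integral_le_eq)
  qed
  have pint: "set_integrable lborel {a<..<b} p" if "0 < a" for a b
    using that by (intro set_integrable_subset[OF int[OF that]]) auto
  have anti: "I b \<le> I a" if "0 < a" "a \<le> b" for a b
  proof -
    have "0 \<le> (LBINT s:{a<..<b}. p s)"
      unfolding set_lebesgue_integral_def using p0 by (intro integral_nonneg_AE) auto
    then show ?thesis
      using I_diff[OF that] by simp
  qed
  have incr: "I a - I b \<le> C * (b - a)" if "0 < a" "a \<le> b" "\<forall>s\<in>{a..b}. p s \<le> C" for a b C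
  proof -
    have "(LBINT s:{a<..<b}. p s) \<le> (LBINT s:{a<..<b}. C)"
      using that by (intro set_integral_mono pint) (auto simp: set_integrable_def)
    then show ?thesis
      using that by (simp add: I_diff set_lebesgue_integral_def mult.commute)
  qed
  show cont: "continuous_on {0<..} I"
    unfolding continuous_on_eq_continuous_at[OF open_greaterThan]
  proof
    fix x :: real assume "x \<in> {0<..}"
    then have x: "x > 0" by simp
    obtain C where C: "\<forall>s\<in>{x / 2..2 * x}. p s \<le> C"
      using bdd[of "x / 2" "2 * x"] x by auto
    have "eventually (\<lambda>y. \<bar>I y - I x\<bar> \<le> C * \<bar>y - x\<bar>) (at x)"
    proof -
      have "eventually (\<lambda>y. y \<in> {x / 2<..<2 * x}) (at x)"
        using x by (intro eventually_at_in_open') auto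
      then show ?thesis
      proof eventually_elim
        case (elim y)
        show ?case
        proof (cases "x \<le> y")
          case True
          then show ?thesis
            using incr[of x y C] anti[of x y] C x elim by auto
        next
          case False
          then show ?thesis
            using incr[of y x C] anti[of y x] C x elim by auto
        qed
      qed
    qed
    then have "((\<lambda>y. I y - I x) \<longlongrightarrow> 0) (at x)"
      by (intro Lim_null_comparison[OF _ tendsto_mult_abs_diff_0]) simp
    then show "isCont I x"
      by (simp add: isCont_def LIM_zero_iff)
  qed
  define I0 where "I0 s = (if s \<in> {0<..} then I s else 0)" for s
  have [measurable]: "I0 \<in> borel_measurable borel"
    unfolding I0_def by (intro borel_measurable_extend_zero borel_measurable_continuous_on_restrict cont) auto
  show qint: "set_integrable lborel {l<..<u} (\<lambda>s. p s / I s)" if lu: "0 < l" "l \<le> u" for l u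
  proof -
    have "set_integrable lborel {l<..<u} (\<lambda>s. p s / I0 s)"
    proof (rule set_integrable_bound)
      show "set_integrable lborel {l<..<u} (\<lambda>s. p s / I u)"
        using pint[OF lu(1)] by (intro set_integrable_divide) auto
      show "set_borel_measurable lborel {l<..<u} (\<lambda>s. p s / I0 s)"
        unfolding set_borel_measurable_def by measurable
      have "p s / I s \<le> p s / I u" if "s \<in> {l<..<u}" for s
        using that lu p0 pos[of u] pos[of s] anti[of s u] by (intro divide_left_mono) auto
      then show "AE s in lborel. s \<in> {l<..<u} \<longrightarrow> norm (p s / I0 s) \<le> norm (p s / I u)"
        using lu p0 pos by (intro AE_I2) (auto simp: I0_def abs_of_pos)
    qed
    moreover have "set_integrable lborel {l<..<u} (\<lambda>s. p s / I0 s) =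
        set_integrable lborel {l<..<u} (\<lambda>s. p s / I s)"
      using lu by (intro set_integrable_cong) (auto simp: I0_def)
    ultimately show ?thesis by simp
  qed
  define \<Psi> where "\<Psi> t = (LBINT s=ereal 1..ereal t. p s / I s) + ln (I t)" for t
  \<comment> \<open>Both the integral of p / I over (a, b) and ln (I a / I b) lie between (I a - I
    b) / I a and (I a - I b) / I b. The gap between these bounds is (I a - I b)^2 / (I a I b), which
    is quadratic in b - a because the local bound on p makes I locally Lipschitz.\<close>
  have quad: "\<bar>\<Psi> b - \<Psi> a\<bar> \<le> (C / I u)\<^sup>2 * (b - a)\<^sup>2"
    if lu: "0 < l" "l \<le> a" "a \<le> b" "b \<le> u" and C: "\<forall>s\<in>{l..u}. p s \<le> C" for l a b u C
  proof -
    define q where "q = (LBINT s:{a<..<b}. p s / I s)"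
    have ab: "0 < a" "a \<le> b" "0 < b" using lu by auto
    have P: "I a > 0" "I b > 0" "I u > 0" "I b \<le> I a" "I u \<le> I b" "I u \<le> I a"
      using lu pos anti by auto
    have diff: "\<Psi> b - \<Psi> a = q - ln (I a / I b)"
      using interval_integral_open_add[OF qint ab(1,2)] P by (simp add: \<Psi>_def q_def ln_div)
    have "(LBINT s:{a<..<b}. p s / I a) \<le> q" unfolding q_def
      using ab p0 pos anti by (intro set_integral_mono qint set_integrable_divide pint) (auto intro!: divide_left_mono)
    then have 1: "(I a - I b) / I a \<le> q"
      using I_diff[OF ab(1,2)] by simp
    have "q \<le> (LBINT s:{a<..<b}. p s / I b)" unfolding q_def
      using ab p0 pos anti by (intro set_integral_mono qint set_integrable_divide pint) (auto intro!: divide_left_mono)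
    then have 2: "q \<le> (I a - I b) / I b"
      using I_diff[OF ab(1,2)] by simp
    have "ln (I a / I b) \<le> I a / I b - 1"
      using P by (intro ln_le_minus_one) auto
    then have 3: "ln (I a / I b) \<le> (I a - I b) / I b"
      using P by (simp add: diff_divide_distrib)
    have "ln (I b / I a) \<le> I b / I a - 1"
      using P by (intro ln_le_minus_one) auto
    then have 4: "(I a - I b) / I a \<le> ln (I a / I b)"
      using P by (simp add: diff_divide_distrib ln_div)
    have "\<bar>\<Psi> b - \<Psi> a\<bar> \<le> (I a - I b) / I b - (I a - I b) / I a"
      unfolding diff using 1 2 3 4 by linarith
    also have "\<dots> = (I a - I b)\<^sup>2 / (I a * I b)"
      using P by (simp add: field_simps power2_eq_square)
    also have "\<dots> \<le> (C * (b - a))\<^sup>2 / (I u * I u)"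
      using P incr[OF ab(1,2), of C] C lu by (intro frac_le power_mono mult_mono) auto
    also have "\<dots> = (C / I u)\<^sup>2 * (b - a)\<^sup>2"
      by (simp add: power2_eq_square)
    finally show ?thesis .
  qed
  have "\<exists>k. \<forall>t\<in>{0<..}. \<Psi> t = k"
  proof (rule has_field_derivative_zero_constant)
    fix x :: real assume "x \<in> {0<..}"
    then have x: "x > 0" by simp
    obtain C where C: "\<forall>s\<in>{x / 2..2 * x}. p s \<le> C"
      using bdd[of "x / 2" "2 * x"] x by auto
    define M where "M = (C / I (2 * x))\<^sup>2"
    have "eventually (\<lambda>y. \<bar>(\<Psi> y - \<Psi> x) / (y - x)\<bar> \<le> M * \<bar>y - x\<bar>) (at x)"
    proof -
      have "eventually (\<lambda>y. y \<in> {x / 2<..<2 * x} \<and> y \<noteq> x) (at x)"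
        using x by (intro eventually_conj eventually_at_in_open') (auto simp: eventually_at_filter)
      then show ?thesis
      proof eventually_elim
        case (elim y)
        have "\<bar>\<Psi> y - \<Psi> x\<bar> \<le> M * (y - x)\<^sup>2"
        proof (cases "x \<le> y")
          case True
          then show ?thesis
            using quad[of "x / 2" x y "2 * x" C] C x elim by (simp add: M_def)
        next
          case False
          then show ?thesis
            using quad[of "x / 2" y x "2 * x" C] C x elim by (simp add: M_def abs_minus_commute power2_commute)
        qed
        also have "(y - x)\<^sup>2 = \<bar>y - x\<bar> * \<bar>y - x\<bar>"
          by (simp add: power2_eq_square)
        finally show ?case
          using elim by (simp add: abs_divide pos_divide_le_eq mult.assoc)
      qed
    qed
    then have "((\<lambda>y. (\<Psi> y - \<Psi> x) / (y - x)) \<longlongrightarrow> 0) (at x)"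
      by (intro Lim_null_comparison[OF _ tendsto_mult_abs_diff_0]) simp
    then have "(\<Psi> has_field_derivative 0) (at x)"
      by (simp add: has_field_derivative_iff)
    then show "(\<Psi> has_field_derivative 0) (at x within {0<..})"
      by (rule has_field_derivative_at_within)
  qed simp
  then have "\<Psi> t = \<Psi> 1" if "t > 0" for t
    using that by (metis greaterThan_iff zero_less_one)
  then show "t > 0 \<Longrightarrow> (LBINT s=ereal 1..ereal t. p s / I s) = ln (I 1) - ln (I t)"
    by (simp add: \<Psi>_def algebra_simps)
qed

section \<open>Weighted tail integrals of F\<close>

lemma locally_bounded_on_Icc:
  fixes F :: "real \<Rightarrow> real"
  assumes "locally_bounded_on {0<..} F" "0 < l"
  obtains C where "\<And>s. s \<in> {l..u} \<Longrightarrow> \<bar>F s\<bar> \<le> C"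
proof -
  have "compact {l..u} \<and> {l..u} \<subseteq> {0<..}"
    using assms(2) by auto
  then have "bounded (F ` {l..u})"
    using assms(1) unfolding locally_bounded_on_def by blast
  then obtain C where "\<forall>y\<in>F ` {l..u}. norm y \<le> C"
    unfolding bounded_iff by blast
  then show ?thesis
    by (intro that[of C]) simp
qed

text \<open>The Potter-type bound at one fixed base point \<open>t0\<close> gives F(s) = O(s^(alpha
  + c/2)), so the integrand is O(s^(-c/2-1)) at infinity. The part of the range below
  \<open>t0\<close> is handled by local boundedness.\<close>

lemma SecondRV_tail_integrable:
  fixes F A :: "real \<Rightarrow> real"
  assumes meas: "F \<in> borel_measurable (restrict_space borel {0<..})"
    and Fpos: "\<forall>t>0. F t > 0" and bdd: "locally_bounded_on {0<..} F"
    and \<rho>: "\<rho> \<le> 0" and A: "A \<in> Aux_infty \<rho>" and F: "F \<in> SecondRV_infty \<alpha> \<rho> A"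
    and \<theta>: "\<theta> < - \<alpha>" and t: "t > 0"
  shows "set_integrable lborel {t<..} (\<lambda>s. s powr (\<theta> - 1) * F s)"
proof -
  define c where "c = - (\<alpha> + \<theta>)"
  have c: "c > 0" using \<theta> by (simp add: c_def)
  define F0 where "F0 s = (if s \<in> {0<..} then F s else 0)" for s
  have [measurable]: "F0 \<in> borel_measurable borel"
    unfolding F0_def by (rule borel_measurable_extend_zero[OF meas]) auto
  obtain K t0 where K: "K > 0" "t0 > 0"
    and bnd: "\<And>t u. t \<ge> t0 \<Longrightarrow> u \<ge> 1 \<Longrightarrow> \<bar>F (t * u) / F t - u powr \<alpha>\<bar> \<le> K * \<bar>A t\<bar> * u powr (\<alpha> + c / 2)"
    using second_order_bound[OF F A \<rho> Fpos, of "c / 2"] c by auto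
  define D where "D = F t0 * (1 + K * \<bar>A t0\<bar>) * t0 powr - (\<alpha> + c / 2)"
  have tail: "s powr (\<theta> - 1) * F s \<le> D * s powr (- (c / 2) - 1)" if s: "s > t0" for s
  proof -
    define u where "u = s / t0"
    have u: "u \<ge> 1" "s = t0 * u"
      using s K by (auto simp: u_def)
    have "u powr \<alpha> \<le> u powr (\<alpha> + c / 2)"
      using u c by (intro powr_mono) auto
    then have "F s / F t0 \<le> (1 + K * \<bar>A t0\<bar>) * u powr (\<alpha> + c / 2)"
      using bnd[of t0 u] u(1) unfolding u(2) by (simp add: distrib_right)
    then have "F s \<le> F t0 * (1 + K * \<bar>A t0\<bar>) * u powr (\<alpha> + c / 2)"
      using Fpos K by (simp add: pos_divide_le_eq mult_ac)
    also have "u powr (\<alpha> + c / 2) = s powr (\<alpha> + c / 2) * t0 powr - (\<alpha> + c / 2)"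
      using K s by (simp only: u_def powr_divide powr_minus_divide) simp
    finally have "F s \<le> D * s powr (\<alpha> + c / 2)"
      by (simp add: D_def mult_ac)
    then have "s powr (\<theta> - 1) * F s \<le> s powr (\<theta> - 1) * (D * s powr (\<alpha> + c / 2))"
      by (intro mult_left_mono) auto
    also have "\<dots> = D * s powr ((\<theta> - 1) + (\<alpha> + c / 2))"
      by (simp add: powr_add)
    also have "(\<theta> - 1) + (\<alpha> + c / 2) = - (c / 2) - 1"
      by (simp add: c_def field_simps)
    finally show ?thesis .
  qed
  have 1: "set_integrable lborel {t0<..} (\<lambda>s. s powr (\<theta> - 1) * F0 s)"
  proof (rule set_integrable_bound)
    show "set_integrable lborel {t0<..} (\<lambda>s. D * s powr (- (c / 2) - 1))"
      using powr_tail_integral(1)[of t0 "c / 2"] K c by (intro set_integrable_mult_right) auto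
    show "set_borel_measurable lborel {t0<..} (\<lambda>s. s powr (\<theta> - 1) * F0 s)"
      unfolding set_borel_measurable_def by measurable
    show "AE s in lborel. s \<in> {t0<..} \<longrightarrow> norm (s powr (\<theta> - 1) * F0 s) \<le> norm (D * s powr (- (c / 2) - 1))"
    proof (intro AE_I2 impI)
      fix s assume s: "s \<in> {t0<..}"
      then have "s > 0" "F s > 0" using K Fpos by auto
      then show "norm (s powr (\<theta> - 1) * F0 s) \<le> norm (D * s powr (- (c / 2) - 1))"
        using order_trans[OF tail[of s] abs_ge_self] s by (simp add: F0_def abs_of_pos)
    qed
  qed
  define m where "m = max t t0"
  have m: "t \<le> m" "t0 \<le> m" "0 < m" using t by (auto simp: m_def)
  obtain C1 where C1: "\<And>s. s \<in> {t..m} \<Longrightarrow> \<bar>F s\<bar> \<le> C1"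
    using locally_bounded_on_Icc[OF bdd t] by blast
  have 2: "set_integrable lborel {t..m} (\<lambda>s. s powr (\<theta> - 1) * F0 s)"
  proof (rule set_integrable_bound)
    have "set_integrable lborel {t..m} (\<lambda>s. s powr (\<theta> - 1))"
      using t by (intro borel_integrable_atLeastAtMost' continuous_intros) auto
    then show "set_integrable lborel {t..m} (\<lambda>s. C1 * s powr (\<theta> - 1))"
      by (intro set_integrable_mult_right)
    show "set_borel_measurable lborel {t..m} (\<lambda>s. s powr (\<theta> - 1) * F0 s)"
      unfolding set_borel_measurable_def by measurable
    show "AE s in lborel. s \<in> {t..m} \<longrightarrow> norm (s powr (\<theta> - 1) * F0 s) \<le> norm (C1 * s powr (\<theta> - 1))"
    proof (intro AE_I2 impI)
      fix s assume s: "s \<in> {t..m}"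
      have "\<bar>F0 s\<bar> \<le> \<bar>C1\<bar>"
        using C1[OF s] s t by (auto simp: F0_def)
      then show "norm (s powr (\<theta> - 1) * F0 s) \<le> norm (C1 * s powr (\<theta> - 1))"
        by (simp add: abs_mult mult.commute mult_right_mono)
    qed
  qed
  have "set_integrable lborel ({t..m} \<union> {t0<..}) (\<lambda>s. s powr (\<theta> - 1) * F0 s)"
    using 1 2 by (intro set_integrable_Un) auto
  then have "set_integrable lborel {t<..} (\<lambda>s. s powr (\<theta> - 1) * F0 s)"
    by (rule set_integrable_subset) (use m in auto)
  also have "set_integrable lborel {t<..} (\<lambda>s. s powr (\<theta> - 1) * F0 s) =
      set_integrable lborel {t<..} (\<lambda>s. s powr (\<theta> - 1) * F s)"
    using t by (intro set_integrable_cong) (auto simp: F0_def)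
  finally show ?thesis .
qed

text \<open>Second-order form of Karamata's theorem: the ratio is \<open>\<integral>u\<^bsup>\<theta>-1\<^esup> F(tu)/F(t) du\<close> over
  \<open>(1, \<infinity>)\<close>, and the second-order bound dominates the difference quotient.\<close>

lemma SecondRV_tail_ratio_limit:
  fixes F A :: "real \<Rightarrow> real"
  assumes meas: "F \<in> borel_measurable (restrict_space borel {0<..})"
    and Fpos: "\<forall>t>0. F t > 0" and bdd: "locally_bounded_on {0<..} F"
    and \<rho>: "\<rho> \<le> 0" and A: "A \<in> Aux_infty \<rho>" and F: "F \<in> SecondRV_infty \<alpha> \<rho> A"
    and \<theta>: "\<theta> < - \<alpha>"
  defines "c \<equiv> - (\<alpha> + \<theta>)"
  shows "((\<lambda>t. ((LBINT s:{t<..}. s powr (\<theta> - 1) * F s) / (t powr \<theta> * F t) - 1 / c) / A t)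
    \<longlongrightarrow> 1 / (c * (c - \<rho>))) at_top"
proof -
  have c: "c > 0" using \<theta> by (simp add: c_def)
  define F0 where "F0 s = (if s \<in> {0<..} then F s else 0)" for s
  have [measurable]: "F0 \<in> borel_measurable borel"
    unfolding F0_def by (rule borel_measurable_extend_zero[OF meas]) auto
  have A_nz: "eventually (\<lambda>t. A t \<noteq> 0) at_top"
    using A by (intro RV_infty_nonzero) (auto simp: Aux_infty_def)
  obtain K t0 where K: "K > 0" "t0 > 0"
    and bnd: "\<And>t u. t \<ge> t0 \<Longrightarrow> u \<ge> 1 \<Longrightarrow> \<bar>F (t * u) / F t - u powr \<alpha>\<bar> \<le> K * \<bar>A t\<bar> * u powr (\<alpha> + c / 2)"
    using second_order_bound[OF F A \<rho> Fpos, of "c / 2"] c by auto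
  \<comment> \<open>Taken at \<open>b = 0\<close> for the limit and the subtracted power, and at
    \<open>b = c / 2\<close> for the majorant.\<close>
  have powr_split: "u powr (\<theta> - 1) * u powr (\<alpha> + b) = u powr (b - c - 1)" for u b
    by (simp add: powr_add[symmetric] c_def algebra_simps)
  define k where "k t u = u powr (\<theta> - 1) * ((F0 (t * u) / F t - u powr \<alpha>) / A t)" for t u
  have L: "((\<lambda>t. LBINT u. indicator {1<..} u *\<^sub>R k t u) \<longlongrightarrow>
      (LBINT u. indicator {1<..} u *\<^sub>R (u powr (- c - 1) * power_kernel \<rho> u))) at_top"
  proof (rule integral_dominated_convergence_at_top)
    show "(\<lambda>u. indicator {1<..} u *\<^sub>R (u powr (- c - 1) * power_kernel \<rho> u)) \<in> borel_measurable lborel"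
      unfolding power_kernel_def by measurable
    show "(\<lambda>u. indicator {1<..} u *\<^sub>R k t u) \<in> borel_measurable lborel" for t
      unfolding k_def by measurable
    show "integrable lborel (\<lambda>u. indicator {1<..} u *\<^sub>R (K * u powr (- (c / 2) - 1)))"
      using powr_tail_integral(1)[of 1 "c / 2"] c
      unfolding set_integrable_def[symmetric] by (intro set_integrable_mult_right) auto
    show "AE u in lborel. ((\<lambda>t. indicator {1<..} u *\<^sub>R k t u) \<longlongrightarrow>
        indicator {1<..} u *\<^sub>R (u powr (- c - 1) * power_kernel \<rho> u)) at_top"
    proof (rule AE_I2)
      fix u :: real
      show "((\<lambda>t. indicator {1<..} u *\<^sub>R k t u) \<longlongrightarrow>
        indicator {1<..} u *\<^sub>R (u powr (- c - 1) * power_kernel \<rho> u)) at_top"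
      proof (cases "u \<in> {1<..}")
        case True
        then have u: "u > 0" by simp
        have "((\<lambda>t. u powr (\<theta> - 1) * ((F (t * u) / F t - u powr \<alpha>) / A t)) \<longlongrightarrow>
            u powr (\<theta> - 1) * (u powr \<alpha> * power_kernel \<rho> u)) at_top"
          by (intro tendsto_intros SecondRV_infty_limit[OF F u])
        moreover have "u powr (\<theta> - 1) * (u powr \<alpha> * power_kernel \<rho> u) = u powr (- c - 1) * power_kernel \<rho> u"
          using powr_split[of u 0] by simp
        moreover have "eventually (\<lambda>t. u powr (\<theta> - 1) * ((F (t * u) / F t - u powr \<alpha>) / A t) = k t u) at_top"
          using eventually_gt_at_top[of 0] by eventually_elim (simp add: k_def F0_def u)
        ultimately have "((\<lambda>t. k t u) \<longlongrightarrow> u powr (- c - 1) * power_kernel \<rho> u) at_top"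
          by (simp only: Lim_transform_eventually)
        then show ?thesis
          using True by simp
      qed simp
    qed
    show "eventually (\<lambda>t. AE u in lborel. norm (indicator {1<..} u *\<^sub>R k t u)
        \<le> indicator {1<..} u *\<^sub>R (K * u powr (- (c / 2) - 1))) at_top"
      using eventually_ge_at_top[of t0] A_nz
    proof eventually_elim
      case (elim t)
      have "\<bar>k t u\<bar> \<le> K * u powr (- (c / 2) - 1)" if u: "u > 1" for u
      proof -
        have "\<bar>F0 (t * u) / F t - u powr \<alpha>\<bar> \<le> K * \<bar>A t\<bar> * u powr (\<alpha> + c / 2)"
          using bnd[of t u] elim(1) K u by (simp add: F0_def)
        then have "\<bar>(F0 (t * u) / F t - u powr \<alpha>) / A t\<bar> \<le> K * u powr (\<alpha> + c / 2)"
          using elim(2) by (simp add: abs_divide pos_divide_le_eq mult_ac)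
        then have "\<bar>k t u\<bar> \<le> u powr (\<theta> - 1) * (K * u powr (\<alpha> + c / 2))"
          unfolding k_def abs_mult by (intro mult_mono) auto
        also have "\<dots> = K * u powr (- (c / 2) - 1)"
          using powr_split[of u "c / 2"] by (simp add: mult_ac)
        finally show ?thesis .
      qed
      then show ?case
        by (intro AE_I2) (simp split: split_indicator)
    qed
  qed
  have L_eq: "(LBINT u. indicator {1<..} u *\<^sub>R (u powr (- c - 1) * power_kernel \<rho> u)) = 1 / (c * (c - \<rho>))"
    using power_kernel_tail_integral[OF c \<rho>] by (simp add: set_lebesgue_integral_def)
  \<comment> \<open>The constant 1 / c is itself the integral over (1, \<infinity>) of u^(-c-1) =
    u^(theta-1) u^alpha. Subtracting it under the integral sign produces the difference quotient
    \<open>k\<close>.\<close>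
  have ev: "eventually (\<lambda>t. (LBINT u. indicator {1<..} u *\<^sub>R k t u) =
      ((LBINT s:{t<..}. s powr (\<theta> - 1) * F s) / (t powr \<theta> * F t) - 1 / c) / A t) at_top"
    using eventually_gt_at_top[of 0]
  proof eventually_elim
    case (elim t)
    define g where "g s = s powr (\<theta> - 1) * F s" for s
    have gint: "integrable lborel (\<lambda>s. indicator {t<..} s *\<^sub>R g s)"
      using SecondRV_tail_integrable[OF meas Fpos bdd \<rho> A F \<theta> elim]
      by (simp add: set_integrable_def g_def)
    have ind: "indicator {t<..} (t * u) = (indicator {1<..} u :: real)" for u
      using elim by (auto simp: indicator_def)
    have "set_integrable lborel {1<..} (\<lambda>u. g (t * u))"
      using lborel_integrable_real_affine[OF gint, of t 0] elim by (simp add: ind set_integrable_def)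
    moreover have g_eq: "g (t * u) = t powr (\<theta> - 1) * F t * (u powr (\<theta> - 1) * (F0 (t * u) / F t))"
      if "u \<in> {1<..}" for u
    proof -
      have "F t > 0" "u > 0" using Fpos elim that by auto
      then show ?thesis
        using elim by (simp add: g_def F0_def powr_mult)
    qed
    define r where "r u = u powr (\<theta> - 1) * (F0 (t * u) / F t)" for u
    have "set_integrable lborel {1<..} (\<lambda>u. g (t * u)) =
        set_integrable lborel {1<..} (\<lambda>u. t powr (\<theta> - 1) * F t * r u)"
      by (rule set_integrable_cong) (auto simp: g_eq r_def)
    moreover have Ft: "t powr (\<theta> - 1) * F t \<noteq> 0" "F t > 0"
      using Fpos elim by (auto simp: less_imp_neq[symmetric])
    ultimately have rint: "set_integrable lborel {1<..} r"
      by simp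
    have "{u. t * u \<in> {t<..}} = {1<..}"
      using elim by auto
    then have "(LBINT s:{t<..}. g s) = t * (LBINT u:{1<..}. g (t * u))"
      using set_integral_scale[OF elim, of "{t<..}" g] by simp
    also have "(LBINT u:{1<..}. g (t * u)) = (LBINT u:{1<..}. t powr (\<theta> - 1) * F t * r u)"
      by (rule set_lebesgue_integral_cong) (auto simp: g_eq r_def)
    also have "\<dots> = t powr (\<theta> - 1) * F t * (LBINT u:{1<..}. r u)"
      by simp
    also have "t * (t powr (\<theta> - 1) * F t * (LBINT u:{1<..}. r u)) = t powr \<theta> * F t * (LBINT u:{1<..}. r u)"
      using elim by (simp add: powr_diff)
    finally have "(LBINT s:{t<..}. g s) / (t powr \<theta> * F t) = (LBINT u:{1<..}. r u)"
      using elim Ft by simp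
    moreover have "(LBINT u:{1<..}. u powr (- c - 1)) = 1 / c"
      using powr_tail_integral(2)[of 1 c] c by simp
    ultimately have "((LBINT s:{t<..}. g s) / (t powr \<theta> * F t) - 1 / c) / A t =
        ((LBINT u:{1<..}. r u) - (LBINT u:{1<..}. u powr (- c - 1))) / A t"
      by simp
    also have "\<dots> = (LBINT u:{1<..}. (r u - u powr (- c - 1)) / A t)"
      using set_integral_diff(2)[OF rint powr_tail_integral(1)[of 1 c]] c by simp
    also have "\<dots> = (LBINT u:{1<..}. k t u)"
    proof (rule set_lebesgue_integral_cong)
      have "(r u - u powr (- c - 1)) / A t = k t u" for u
        using powr_split[of u 0] by (simp add: r_def k_def right_diff_distrib)
      then show "\<forall>u. u \<in> {1<..} \<longrightarrow> (r u - u powr (- c - 1)) / A t = k t u"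
        by simp
    qed simp
    finally show ?case
      by (simp add: g_def set_lebesgue_integral_def)
  qed
  show ?thesis
    using Lim_transform_eventually[OF L ev] unfolding L_eq .
qed

subsection \<open>Necessity of the representation\<close>

lemma SecondRV_imp_representation:
  fixes F A :: "real \<Rightarrow> real"
  assumes meas: "F \<in> borel_measurable (restrict_space borel {0<..})"
    and Fpos: "\<forall>t>0. F t > 0" and bdd: "locally_bounded_on {0<..} F"
    and \<rho>: "\<rho> \<le> 0" and A: "A \<in> Aux_infty \<rho>" and F: "F \<in> SecondRV_infty \<alpha> \<rho> A"
    and \<theta>: "\<theta> < - \<alpha>"
  shows "\<exists>B. second_order_representation F \<alpha> \<rho> A
    (- (\<alpha> + \<theta>) * (LBINT s=ereal 1..\<infinity>. s powr (\<theta> - 1) * F s)) (1 / (\<alpha> + \<theta>)) B"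
proof -
  define c where "c = - (\<alpha> + \<theta>)"
  have c: "c > 0" using \<theta> by (simp add: c_def)
  define p where "p s = (if s \<in> {0<..} then s powr (\<theta> - 1) * F s else 0)" for s
  define I where "I t = (LBINT s:{t<..}. p s)" for t
  have p_meas [measurable]: "p \<in> borel_measurable borel"
    unfolding p_def
  proof (rule borel_measurable_extend_zero)
    have "(\<lambda>s. s powr (\<theta> - 1)) \<in> borel_measurable (restrict_space borel {0<..})"
      by (intro measurable_restrict_space1) measurable
    then show "(\<lambda>s. s powr (\<theta> - 1) * F s) \<in> borel_measurable (restrict_space borel {0<..})"
      using meas by (rule borel_measurable_times)
  qed simp
  have p0: "p s \<ge> 0" for s
    using Fpos by (auto simp: p_def less_imp_le)
  have p_bdd: "\<exists>C. \<forall>s\<in>{l..u}. p s \<le> C" if "0 < l" "l \<le> u" for l u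
  proof -
    obtain C1 where C1: "\<And>s. s \<in> {l..u} \<Longrightarrow> \<bar>F s\<bar> \<le> C1"
      using locally_bounded_on_Icc[OF bdd \<open>0 < l\<close>] by blast
    have "bounded ((\<lambda>s. s powr (\<theta> - 1)) ` {l..u})"
      using that by (intro compact_imp_bounded compact_continuous_image continuous_intros) auto
    then obtain C2 where "\<forall>y\<in>(\<lambda>s. s powr (\<theta> - 1)) ` {l..u}. norm y \<le> C2"
      unfolding bounded_iff by blast
    then have C2: "\<bar>s powr (\<theta> - 1)\<bar> \<le> C2" if "s \<in> {l..u}" for s
      using that by simp
    have "p s \<le> C2 * C1" if s: "s \<in> {l..u}" for s
    proof -
      have "\<bar>s powr (\<theta> - 1)\<bar> * \<bar>F s\<bar> \<le> C2 * C1"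
        using C1[OF s] C2[OF s] abs_ge_zero[of "s powr (\<theta> - 1)"] by (intro mult_mono) linarith+
      moreover have "F s > 0" "s > 0"
        using s Fpos \<open>0 < l\<close> by auto
      ultimately show ?thesis
        by (simp add: p_def)
    qed
    then show ?thesis by blast
  qed
  have p_int: "set_integrable lborel {t<..} p" if "t > 0" for t
  proof -
    have "set_integrable lborel {t<..} p = set_integrable lborel {t<..} (\<lambda>s. s powr (\<theta> - 1) * F s)"
      using that by (intro set_integrable_cong) (auto simp: p_def)
    then show ?thesis
      using SecondRV_tail_integrable[OF meas Fpos bdd \<rho> A F \<theta> that] by simp
  qed
  have I_eq: "I t = (LBINT s:{t<..}. s powr (\<theta> - 1) * F s)" if "t > 0" for t
    unfolding I_def using that by (intro set_lebesgue_integral_cong) (auto simp: p_def)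
  have I_pos: "I t > 0" if t: "t > 0" for t
  proof -
    have "I t \<ge> 0"
      unfolding I_def set_lebesgue_integral_def using p0 by (intro integral_nonneg_AE) auto
    \<comment> \<open>A vanishing integral of the nonnegative \<open>p\<close> would make
      \<open>p\<close> zero almost everywhere beyond \<open>t\<close>, yet it is positive on an
      interval of length 1.\<close>
    moreover have "I t \<noteq> 0"
    proof
      assume "I t = 0"
      then have "AE s in lborel. indicator {t<..} s *\<^sub>R p s = 0"
        using p_int[OF t] p0 unfolding I_def set_lebesgue_integral_def set_integrable_def
        by (subst (asm) integral_nonneg_eq_0_iff_AE) auto
      then have "AE s in lborel. s \<notin> {t<..<t + 1}"
      proof eventually_elim
        case (elim s)
        have "p s > 0" if "s > t"
          using that t Fpos by (auto simp: p_def)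
        with elim show ?case by (auto simp: indicator_def split: if_splits)
      qed
      then have "emeasure lborel {t<..<t + 1} = 0"
        by (subst (asm) AE_iff_measurable[of "{t<..<t + 1}"]) auto
      then show False
        by simp
    qed
    ultimately show ?thesis by simp
  qed
  note I_pos' = I_pos[unfolded I_def]
  have I_cont: "continuous_on {0<..} I"
    unfolding I_def
    by (rule integral_over_tail_integral(1)) (fact p_meas p0 p_bdd p_int I_pos')+
  have quot_int: "set_integrable lborel {l<..<u} (\<lambda>s. p s / I s)" if "0 < l" "l \<le> u" for l u
    unfolding I_def
    by (rule integral_over_tail_integral(2)) (fact p_meas p0 p_bdd p_int I_pos' that)+
  have quot_integral: "(LBINT s=ereal 1..ereal t. p s / I s) = ln (I 1) - ln (I t)" if "t > 0" for t
    unfolding I_def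
    by (rule integral_over_tail_integral(3)) (fact p_meas p0 p_bdd p_int I_pos' that)+
  define B where "B t = c - t powr \<theta> * F t / I t" for t
  define J where "J t = I t / (t powr \<theta> * F t)" for t
  \<comment> \<open>The second form is what is integrated in the exponent. The third reduces the
    asymptotics of \<open>B\<close> to those of the Karamata ratio \<open>J\<close>, whose limit is
    1 / c.\<close>
  have B_eq: "B t = c - t * p t / I t" "B t / t = c / t - p t / I t" "B t = (c * J t - 1) / J t" if "t > 0" for t
  proof -
    have "t powr \<theta> * F t = t * p t"
      using that by (simp add: p_def powr_diff)
    then show "B t = c - t * p t / I t"
      by (simp add: B_def)
    then show "B t / t = c / t - p t / I t"
      using that by (simp add: diff_divide_distrib)
    have "c - y / x = (c * (x / y) - 1) / (x / y)" if "x > 0" "y > 0" for x y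
      using that by (simp add: field_simps)
    from this[OF I_pos[OF that], of "t powr \<theta> * F t"] show "B t = (c * J t - 1) / J t"
      using Fpos that by (simp add: B_def J_def)
  qed
  have J_pos: "J t > 0" if "t > 0" for t
    using I_pos[OF that] Fpos that by (simp add: J_def)
  have ARV: "A \<in> RV_infty \<rho>" and A_0: "(A \<longlongrightarrow> 0) at_top"
    using A by (auto simp: Aux_infty_def)
  note A_nz = RV_infty_nonzero[OF ARV]
  have ev_J: "eventually (\<lambda>t. ((LBINT s:{t<..}. s powr (\<theta> - 1) * F s) / (t powr \<theta> * F t) - 1 / c) / A t
      = (J t - 1 / c) / A t) at_top"
    using eventually_gt_at_top[of 0] by eventually_elim (simp add: J_def I_eq)
  have J_lim: "((\<lambda>t. (J t - 1 / c) / A t) \<longlongrightarrow> 1 / (c * (c - \<rho>))) at_top"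
    using Lim_transform_eventually[OF
        SecondRV_tail_ratio_limit[OF meas Fpos bdd \<rho> A F \<theta>, folded c_def] ev_J] .
  have "((\<lambda>t. (J t - 1 / c) / A t * A t + 1 / c) \<longlongrightarrow> 1 / (c * (c - \<rho>)) * 0 + 1 / c) at_top"
    by (intro tendsto_intros J_lim A_0)
  moreover have "eventually (\<lambda>t. (J t - 1 / c) / A t * A t + 1 / c = J t) at_top"
    using A_nz by eventually_elim simp
  ultimately have "(J \<longlongrightarrow> 1 / (c * (c - \<rho>)) * 0 + 1 / c) at_top"
    by (rule Lim_transform_eventually)
  then have J_c: "(J \<longlongrightarrow> 1 / c) at_top"
    by simp
  define w where "w t = B t / A t" for t
  \<comment> \<open>The limit of B / A; its inverse 1 - \<rho> / c is the required
    \<open>\<rho> * \<zeta>\<^sub>2 + 1\<close>. Being positive, it lets \<open>B\<close> inherit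
    sign, regular variation and convergence to 0 from A.\<close>
  define m where "m = c / (c - \<rho>)"
  have m: "m > 0" using c \<rho> by (simp add: m_def)
  have "((\<lambda>t. c * ((J t - 1 / c) / A t) / J t) \<longlongrightarrow> c * (1 / (c * (c - \<rho>))) / (1 / c)) at_top"
    using c by (intro tendsto_intros J_lim J_c) auto
  moreover have "eventually (\<lambda>t. c * ((J t - 1 / c) / A t) / J t = w t) at_top"
    using eventually_gt_at_top[of 0]
  proof eventually_elim
    case (elim t)
    have "c * (J t - 1 / c) = c * J t - 1"
      using c by (simp add: right_diff_distrib)
    then show ?case
      unfolding w_def B_eq(3)[OF elim] by (simp add: mult_ac)
  qed
  ultimately have "(w \<longlongrightarrow> c * (1 / (c * (c - \<rho>))) / (1 / c)) at_top"
    by (rule Lim_transform_eventually)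
  then have w: "(w \<longlongrightarrow> m) at_top"
    using c by (simp add: m_def)
  have w_pos: "eventually (\<lambda>t. w t > 0) at_top"
    using order_tendstoD(1)[OF w m] .
  have B_w: "eventually (\<lambda>t. B t = w t * A t) at_top"
    using A_nz by eventually_elim (simp add: w_def)

  have "B \<in> RV_infty \<rho>"
    unfolding RV_infty_def
  proof (intro CollectI conjI allI impI)
    have "I \<in> borel_measurable (restrict_space borel {0<..})"
      by (intro borel_measurable_continuous_on_restrict I_cont)
    moreover have "(\<lambda>s. s powr \<theta>) \<in> borel_measurable (restrict_space borel {0<..})"
      by (intro measurable_restrict_space1) measurable
    ultimately show "B \<in> borel_measurable (restrict_space borel {0<..})"
      unfolding B_def using meas
      by (intro borel_measurable_diff borel_measurable_divide borel_measurable_times borel_measurable_const)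
    consider "eventually (\<lambda>t. A t > 0) at_top" | "eventually (\<lambda>t. A t < 0) at_top"
      using ARV by (auto simp: RV_infty_def constant_sign_near_infinity_def)
    then show "constant_sign_near_infinity B"
    proof cases
      case 1
      then have "eventually (\<lambda>t. B t > 0) at_top"
        using B_w w_pos by eventually_elim simp
      then show ?thesis by (simp add: constant_sign_near_infinity_def)
    next
      case 2
      then have "eventually (\<lambda>t. B t < 0) at_top"
        using B_w w_pos by eventually_elim (simp add: mult_pos_neg)
      then show ?thesis by (simp add: constant_sign_near_infinity_def)
    qed
    fix x :: real assume x: "x > 0"
    have scale: "filterlim (\<lambda>t. t * x) at_top at_top"
      using x by (intro filterlim_at_top_mult_tendsto_pos[OF tendsto_const] filterlim_ident)
    have "((\<lambda>t. w (t * x) / w t * (A (t * x) / A t)) \<longlongrightarrow> m / m * x powr \<rho>) at_top"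
      using m x ARV by (intro tendsto_intros w filterlim_compose[OF w scale]) (auto simp: RV_infty_def)
    moreover have "eventually (\<lambda>t. w (t * x) / w t * (A (t * x) / A t) = B (t * x) / B t) at_top"
      using B_w eventually_compose_filterlim[OF B_w scale] by eventually_elim simp
    ultimately have "((\<lambda>t. B (t * x) / B t) \<longlongrightarrow> m / m * x powr \<rho>) at_top"
      by (rule Lim_transform_eventually)
    then show "((\<lambda>t. B (t * x) / B t) \<longlongrightarrow> x powr \<rho>) at_top"
      using m by simp
  qed
  moreover have "(B \<longlongrightarrow> 0) at_top"
  proof -
    have "((\<lambda>t. w t * A t) \<longlongrightarrow> m * 0) at_top"
      by (intro tendsto_intros w A_0)
    moreover have "eventually (\<lambda>t. w t * A t = B t) at_top"
      using B_w by eventually_elim simp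
    ultimately have "(B \<longlongrightarrow> m * 0) at_top"
      by (rule Lim_transform_eventually)
    then show ?thesis by simp
  qed
  ultimately have B_Aux: "B \<in> Aux_infty \<rho>"
    by (simp add: Aux_infty_def)
  have m_eq: "\<rho> * (1 / (\<alpha> + \<theta>)) + 1 = inverse m"
  proof -
    have "\<alpha> + \<theta> = - c" by (simp add: c_def)
    then show ?thesis
      using c by (simp add: m_def diff_divide_distrib)
  qed
  have A_B: "((\<lambda>t. A t / B t) \<longlongrightarrow> inverse m) at_top"
  proof -
    have "((\<lambda>t. inverse (w t)) \<longlongrightarrow> inverse m) at_top"
      using m by (intro tendsto_inverse w) auto
    then show ?thesis by (simp add: w_def)
  qed

  have rep: "interval_lebesgue_integrable lborel (ereal 1) (ereal t) (\<lambda>s. B s / s) \<and>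
      F t = c * I 1 * (1 + 1 / (\<alpha> + \<theta>) * B t) * exp (LBINT s=ereal 1..ereal t. B s / s) * t powr \<alpha>"
    if t: "t > 0" for t
  proof -
    have pos: "s > 0" if "s \<in> einterval (min (ereal 1) (ereal t)) (max (ereal 1) (ereal t))" for s
      using that t by (auto simp: einterval_iff min_def split: if_splits)
    have i1: "interval_lebesgue_integrable lborel (ereal 1) (ereal t) (\<lambda>s. c / s)"
      using t by (intro interval_integrable_isCont continuous_intros) (auto simp: min_def split: if_splits)
    have i2: "interval_lebesgue_integrable lborel (ereal 1) (ereal t) (\<lambda>s. p s / I s)"
      using quot_int[of 1 t] quot_int[of t 1] t by (auto simp: interval_lebesgue_integrable_def)
    have int_eq: "interval_lebesgue_integrable lborel (ereal 1) (ereal t) (\<lambda>s. B s / s) =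
        interval_lebesgue_integrable lborel (ereal 1) (ereal t) (\<lambda>s. c / s - p s / I s)"
      unfolding interval_lebesgue_integrable_def
      using t by (intro if_cong refl set_integrable_cong) (auto simp: B_eq(2))
    have "(LBINT s=ereal 1..ereal t. B s / s) = (LBINT s=ereal 1..ereal t. c / s - p s / I s)"
      using pos by (intro interval_integral_cong) (simp add: B_eq(2))
    also have "\<dots> = (LBINT s=ereal 1..ereal t. c / s) - (LBINT s=ereal 1..ereal t. p s / I s)"
      by (rule interval_lebesgue_integral_diff(2)[OF i1 i2])
    \<comment> \<open>Written as a power with exponent 0 - 1, so that the closed form of the kernel
      integral at \<rho> = 0 yields the logarithm.\<close>
    also have "(LBINT s=ereal 1..ereal t. c / s) = (LBINT s=ereal 1..ereal t. c * s powr (0 - 1))"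
      by (intro interval_integral_cong) (use pos in \<open>simp add: powr_minus_divide abs_of_pos\<close>)
    also have "\<dots> = c * ln t"
      by (simp only: interval_lebesgue_integral_mult_right interval_integral_powr[OF t])
        (simp add: power_kernel_def)
    also have "(LBINT s=ereal 1..ereal t. p s / I s) = ln (I 1) - ln (I t)"
      using t by (rule quot_integral)
    finally have "exp (LBINT s=ereal 1..ereal t. B s / s) = exp (c * ln t) * exp (ln (I t)) / exp (ln (I 1))"
      by (simp add: exp_add exp_diff)
    then have E: "exp (LBINT s=ereal 1..ereal t. B s / s) = t powr c * I t / I 1"
      using t I_pos[OF t] I_pos[of 1] by (simp add: powr_def)
    have "1 + 1 / (\<alpha> + \<theta>) * B t = t powr \<theta> * F t / (c * I t)"
    proof -
      have "\<alpha> + \<theta> = - c" by (simp add: c_def)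
      then show ?thesis
        using c by (simp add: B_def diff_divide_distrib)
    qed
    then have "c * I 1 * (1 + 1 / (\<alpha> + \<theta>) * B t) * exp (LBINT s=ereal 1..ereal t. B s / s) * t powr \<alpha>
        = F t * (t powr \<theta> * t powr c * t powr \<alpha>)"
      unfolding E using c I_pos[OF t] I_pos[of 1] by simp
    \<comment> \<open>The exponents cancel by the choice of \<open>c\<close>.\<close>
    also have "t powr \<theta> * t powr c * t powr \<alpha> = 1"
      using t by (simp add: powr_add[symmetric] c_def)
    finally show ?thesis
      using int_eq interval_lebesgue_integral_diff(1)[OF i1 i2] by simp
  qed
  have "(LBINT s=ereal 1..\<infinity>. s powr (\<theta> - 1) * F s) = I 1"
    by (simp add: I_eq interval_integral_to_infinity_eq)
  then have "second_order_representation F \<alpha> \<rho> A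
      (- (\<alpha> + \<theta>) * (LBINT s=ereal 1..\<infinity>. s powr (\<theta> - 1) * F s)) (1 / (\<alpha> + \<theta>)) B"
    unfolding second_order_representation_def m_eq
    using rep B_Aux A_B m c I_pos[of 1] by (auto simp: c_def)
  then show ?thesis by blast
qed

theorem theorem3p2:
  fixes F A :: "real \<Rightarrow> real" and \<alpha> \<rho> :: real
  assumes "F \<in> borel_measurable (restrict_space borel {0<..})"
    and "\<forall>t>0. F t > 0"
    and "locally_bounded_on {0<..} F"
    and "\<rho> \<le> 0"
    and "A \<in> Aux_infty \<rho>"
  shows "(F \<in> SecondRV_infty \<alpha> \<rho> A \<longleftrightarrow>
            (\<exists>\<zeta>\<^sub>1 \<zeta>\<^sub>2 A\<^sub>1. second_order_representation F \<alpha> \<rho> A \<zeta>\<^sub>1 \<zeta>\<^sub>2 A\<^sub>1)) \<and>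
         (F \<in> SecondRV_infty \<alpha> \<rho> A \<longrightarrow>
            (\<forall>\<theta>. \<theta> < - \<alpha> \<longrightarrow>
               interval_lebesgue_integrable lborel (ereal 1) \<infinity> (\<lambda>s. s powr (\<theta> - 1) * F s) \<and>
               (\<exists>A\<^sub>1. second_order_representation F \<alpha> \<rho> A
                  (- (\<alpha> + \<theta>) * (LBINT s=ereal 1..\<infinity>. s powr (\<theta> - 1) * F s))
                  (1 / (\<alpha> + \<theta>)) A\<^sub>1)))"
proof -
  have rep: "interval_lebesgue_integrable lborel (ereal 1) \<infinity> (\<lambda>s. s powr (\<theta> - 1) * F s) \<and>
      (\<exists>A\<^sub>1. second_order_representation F \<alpha> \<rho> A
        (- (\<alpha> + \<theta>) * (LBINT s=ereal 1..\<infinity>. s powr (\<theta> - 1) * F s)) (1 / (\<alpha> + \<theta>)) A\<^sub>1)"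
    if "F \<in> SecondRV_infty \<alpha> \<rho> A" "\<theta> < - \<alpha>" for \<theta>
    using SecondRV_imp_representation[OF assms that] SecondRV_tail_integrable[OF assms that zero_less_one]
    by (simp add: interval_integrable_to_infinity_eq)
  \<comment> \<open>The equivalence mentions no \<theta>, so any admissible value may serve as
    witness; this one gives \<open>\<zeta>\<^sub>2 = - 1\<close>.\<close>
  have "- \<alpha> - 1 < - \<alpha>" by simp
  then show ?thesis
    using rep representation_imp_SecondRV[OF assms(1,2,5)] by blast
qed

end
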